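(* Let $\Gamma$ be a metrized graph with $\ell(\Gamma)=1$ and edges $e_1,\dots,e_e$ of lengths $L_i$. For each $i=1,\dots,e$ let $\beta^i$ be a metrized graph with $\ell(\beta^i)=1$ and let $p_i,q_i$ be two distinct points in the vertex set of $\beta^i$. Let $\Gamma\star\prod_{i=1}^e\beta^i_{p_i,q_i}$ be as defined in the context and $\big(\Gamma\star\prod_{i=1}^e\beta^i_{p_i,q_i}\big)^N$ its normalization. Then $$\tau\Big(\big(\Gamma\star\prod_{i=1}^e\beta^i_{p_i,q_i}\big)^N\Big)\sum_{i=1}^{e}\frac{L_i}{r_{\beta^i}(p_i,q_i)}=\tau(\Gamma)-\frac14+\sum_{i=1}^{e}\Big[\frac{L_i\,\tau(\beta^i)}{r_{\beta^i}(p_i,q_i)}+\frac{L_i^2A_{p_i,q_i,\beta^i}}{(L_i+R_i)\,r_{\beta^i}(p_i,q_i)^2}\Big].$$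
   Context: A metrized graph is a finite connected graph (multiple edges and self-loops allowed) in which each edge is identified with a closed interval of positive length, with a finite non-empty vertex set containing all points of valence $\ne2$; $\ell(\cdot)$ is total length, and the normalization $G^N$ divides all edge lengths by $\ell(G)$. Regard graphs as resistive circuits with segment resistance equal to length; $r_G(x,y)$ is effective resistance in $G$, and $j_z(x,y)$ is the potential at $x$ when unit current enters at $y$ and exits at $z$, with potential $0$ at $z$. For a graph $\beta$ and points $p,q$, $A_{p,q,\beta}=\int_\beta j_x(p,q)\big(\frac{d}{dx}j_p(x,q)\big)^2dx$ ($dx$ arclength). For an edge $e_i$ of $\Gamma$ with end points (labeled) $u_i,w_i$, $R_i$ is the effective resistance between $u_i,w_i$ in $\Gamma-e_i$ ($\Gamma$ with the interior of $e_i$ removed); if $\Gamma-e_i$ is disconnected, $R_i=\infty$ and the term with $\frac{1}{L_i+R_i}$ is $0$. Construction: let $\beta_i$ be $\beta^i$ with every edge length multiplied by $L_i/r_{\beta^i}(p_i,q_i)$; replace each edge $e_i$ of $\Gamma$ by $\beta_i$, identifying $u_i$ with $p_i$ and $w_i$ with $q_i$; the result is $\Gamma\star\prod_{i=1}^e\beta^i_{p_i,q_i}$. The tau constant is $\tau(G)=\frac14\int_G\big(\frac{\partial}{\partial x}r_G(x,y)\big)^2dx$ (independent of $y$). *)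

theory Defs
  imports "Graph_Theory.Digraph_Component" "HOL-Analysis.Analysis"
begin

text \<open>
  A metrized graph is presented by a finite connected multigraph (loops and parallel arcs allowed)
  with positive arc lengths; the arc \<open>e\<close> stands for the interval \<open>[0, len G e]\<close> running from
  \<open>tail e\<close> to \<open>head e\<close>. The orientation only serves to label the end points and to parametrize
  the edge; connectedness is that of the underlying undirected graph. Points in the interior of an
  arc have valence 2, so the vertex set automatically contains all points of valence other than 2.
\<close>

record ('v, 'e) mgraph =
  skel :: "('v, 'e) pre_digraph"
  len :: "'e \<Rightarrow> real"

abbreviation edges :: "('v, 'e) mgraph \<Rightarrow> 'e set" where
  "edges G \<equiv> arcs (skel G)"

abbreviation vertices :: "('v, 'e) mgraph \<Rightarrow> 'v set" where
  "vertices G \<equiv> verts (skel G)"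

abbreviation src :: "('v, 'e) mgraph \<Rightarrow> 'e \<Rightarrow> 'v" where
  "src G \<equiv> tail (skel G)"

abbreviation tgt :: "('v, 'e) mgraph \<Rightarrow> 'e \<Rightarrow> 'v" where
  "tgt G \<equiv> head (skel G)"

definition metrized_graph :: "('v, 'e) mgraph \<Rightarrow> bool" where
  "metrized_graph G \<longleftrightarrow>
     fin_digraph (skel G) \<and> Digraph_Component.connected (skel G) \<and> (\<forall>e\<in>edges G. 0 < len G e)"

definition total_length :: "('v, 'e) mgraph \<Rightarrow> real" where
  "total_length G = (\<Sum>e\<in>edges G. len G e)"

definition normalization :: "('v, 'e) mgraph \<Rightarrow> ('v, 'e) mgraph" where
  "normalization G = G\<lparr>len := \<lambda>e. len G e / total_length G\<rparr>"

definition delete_edge :: "('v, 'e) mgraph \<Rightarrow> 'e \<Rightarrow> ('v, 'e) mgraph" where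
  "delete_edge G e = G\<lparr>skel := pre_digraph.del_arc (skel G) e\<rparr>"

datatype ('v, 'e) gpoint = Vertex 'v | Inner 'e real

definition points :: "('v, 'e) mgraph \<Rightarrow> ('v, 'e) gpoint set" where
  "points G = Vertex ` vertices G \<union> {Inner e t | e t. e \<in> edges G \<and> 0 < t \<and> t < len G e}"

text \<open>Arclength parametrization of the edge \<open>e\<close>, meant for \<open>0 \<le> t \<le> len G e\<close>.\<close>

definition pt :: "('v, 'e) mgraph \<Rightarrow> 'e \<Rightarrow> real \<Rightarrow> ('v, 'e) gpoint" where
  "pt G e t =
     (if t \<le> 0 then Vertex (src G e) else if len G e \<le> t then Vertex (tgt G e) else Inner e t)"

text \<open>
  Currents flowing out of the point at parameter \<open>t\<close> of the edge \<open>e\<close> in the two directions along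
  the edge, for the potential \<open>f\<close> and unit resistance per length: minus the slope of \<open>f\<close>
  in the respective direction.
\<close>

definition current_fwd :: "('v, 'e) mgraph \<Rightarrow> (('v, 'e) gpoint \<Rightarrow> real) \<Rightarrow> 'e \<Rightarrow> real \<Rightarrow> real" where
  "current_fwd G f e t = - vector_derivative (\<lambda>s. f (pt G e s)) (at t within {t..len G e})"

definition current_bwd :: "('v, 'e) mgraph \<Rightarrow> (('v, 'e) gpoint \<Rightarrow> real) \<Rightarrow> 'e \<Rightarrow> real \<Rightarrow> real" where
  "current_bwd G f e t = vector_derivative (\<lambda>s. f (pt G e s)) (at t within {0..t})"

text \<open>A loop at \<open>v\<close> contributes to both sums.\<close>

fun outflow :: "('v, 'e) mgraph \<Rightarrow> (('v, 'e) gpoint \<Rightarrow> real) \<Rightarrow> ('v, 'e) gpoint \<Rightarrow> real" where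
  "outflow G f (Vertex v) =
     (\<Sum>e | e \<in> edges G \<and> src G e = v. current_fwd G f e 0) +
     (\<Sum>e | e \<in> edges G \<and> tgt G e = v. current_bwd G f e (len G e))"
| "outflow G f (Inner e t) = current_fwd G f e t + current_bwd G f e t"

text \<open>
  \<open>f\<close> is an electric potential on \<open>G\<close> when unit current enters at \<open>y\<close> and exits at \<open>z\<close>.
  First clause (Ohm): a segment \<open>[a, b]\<close> of an edge without terminal in its interior
  carries a constant current \<open>c\<close>, and each part of it has resistance equal to its length.
  Second clause (Kirchhoff): at every point the net current sent into the graph equals
  the current supplied there from outside.
\<close>

definition unit_potential ::
  "('v, 'e) mgraph \<Rightarrow> ('v, 'e) gpoint \<Rightarrow> ('v, 'e) gpoint \<Rightarrow> (('v, 'e) gpoint \<Rightarrow> real) \<Rightarrow> bool" where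
  "unit_potential G y z f \<longleftrightarrow>
     (\<forall>e\<in>edges G. \<forall>a b. 0 \<le> a \<and> a < b \<and> b \<le> len G e \<and>
        (\<forall>t\<in>{a<..<b}. pt G e t \<noteq> y \<and> pt G e t \<noteq> z) \<longrightarrow>
        (\<exists>c. \<forall>t\<in>{a..b}. f (pt G e a) - f (pt G e t) = c * (t - a))) \<and>
     (\<forall>x\<in>points G. outflow G f x = of_bool (x = y) - of_bool (x = z))"

text \<open>
  \<open>jfun G z x y\<close> is $j_z(x,y)$: the potential at \<open>x\<close> when unit current enters at \<open>y\<close> and
  exits at \<open>z\<close>, with potential 0 at \<open>z\<close>.
\<close>

definition jfun ::
  "('v, 'e) mgraph \<Rightarrow> ('v, 'e) gpoint \<Rightarrow> ('v, 'e) gpoint \<Rightarrow> ('v, 'e) gpoint \<Rightarrow> real" where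
  "jfun G z x y = (THE c. \<exists>f. unit_potential G y z f \<and> f z = 0 \<and> f x = c)"

definition eff_res :: "('v, 'e) mgraph \<Rightarrow> ('v, 'e) gpoint \<Rightarrow> ('v, 'e) gpoint \<Rightarrow> real" where
  "eff_res G x y = (THE c. \<exists>f. unit_potential G x y f \<and> f x - f y = c)"

text \<open>
  Integration with respect to arclength, for integrands given in the edge parametrization,
  and derivative along an edge. The derivatives below exist off a finite set of points.
\<close>

definition graph_integral :: "('v, 'e) mgraph \<Rightarrow> ('e \<Rightarrow> real \<Rightarrow> real) \<Rightarrow> real" where
  "graph_integral G h = (\<Sum>e\<in>edges G. integral {0..len G e} (h e))"

definition edge_deriv :: "('v, 'e) mgraph \<Rightarrow> (('v, 'e) gpoint \<Rightarrow> real) \<Rightarrow> 'e \<Rightarrow> real \<Rightarrow> real" where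
  "edge_deriv G f e t = deriv (\<lambda>s. f (pt G e s)) t"

definition tau :: "('v, 'e) mgraph \<Rightarrow> real" where
  "tau G = (THE c. \<forall>y\<in>points G.
     c = 1/4 * graph_integral G (\<lambda>e t. (edge_deriv G (\<lambda>x. eff_res G x y) e t)\<^sup>2))"

definition A_const :: "('v, 'e) mgraph \<Rightarrow> ('v, 'e) gpoint \<Rightarrow> ('v, 'e) gpoint \<Rightarrow> real" where
  "A_const G p q = graph_integral G
     (\<lambda>e t. jfun G (pt G e t) p q * (edge_deriv G (\<lambda>x. jfun G p x q) e t)\<^sup>2)"

definition edge_res :: "('v, 'e) mgraph \<Rightarrow> 'e \<Rightarrow> ereal" where
  "edge_res G e =
     (if Digraph_Component.connected (skel (delete_edge G e))
      then ereal (eff_res (delete_edge G e) (Vertex (src G e)) (Vertex (tgt G e)))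
      else \<infinity>)"

text \<open>
  The edge replacement: every edge \<open>i\<close> of \<open>G\<close> is replaced by a copy of \<open>B i\<close>, rescaled so that
  the resistance between \<open>p i\<close> and \<open>q i\<close> becomes \<open>len G i\<close>, with \<open>p i\<close> glued to the tail of \<open>i\<close>
  and \<open>q i\<close> to its head. If \<open>i\<close> is a loop, then \<open>p i\<close> and \<open>q i\<close> get identified with each other.
\<close>

definition glue ::
  "('v, 'e) mgraph \<Rightarrow> ('e \<Rightarrow> 'w) \<Rightarrow> ('e \<Rightarrow> 'w) \<Rightarrow> 'e \<Rightarrow> 'w \<Rightarrow> 'v + 'e \<times> 'w" where
  "glue G p q i w =
     (if w = p i then Inl (src G i) else if w = q i then Inl (tgt G i) else Inr (i, w))"

definition edge_replacement ::
  "('v, 'e) mgraph \<Rightarrow> ('e \<Rightarrow> ('w, 'f) mgraph) \<Rightarrow> ('e \<Rightarrow> 'w) \<Rightarrow> ('e \<Rightarrow> 'w)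
     \<Rightarrow> ('v + 'e \<times> 'w, 'e \<times> 'f) mgraph" where
  "edge_replacement G B p q =
     \<lparr> skel =
         \<lparr> verts = Inl ` vertices G \<union> (\<Union>i\<in>edges G. glue G p q i ` vertices (B i)),
           arcs = (SIGMA i:edges G. edges (B i)),
           tail = (\<lambda>(i, e). glue G p q i (src (B i) e)),
           head = (\<lambda>(i, e). glue G p q i (tgt (B i) e)) \<rparr>,
       len = (\<lambda>(i, e). len (B i) e * (len G i / eff_res (B i) (Vertex (p i)) (Vertex (q i)))) \<rparr>"

end

theory Submission
  imports Defs
begin

text \<open>
  Everything reduces to the Dirichlet form \<open>energy\<close> on vertex functions and to its Green kernel \<open>g\<close>,
  grounded at one vertex. Along an edge of length \<open>L\<close> with slack \<open>F = 1 - r/L\<close>, where \<open>r\<close> is the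
  resistance between its end points, the resistance to a fixed point is the linear interpolation
  plus \<open>F t (L - t) / L\<close>; hence $4\tau$ is the energy of \<open>v \<mapsto> g v v\<close> plus a third of the sum of
  \<open>F\<^sup>2 L\<close>. An inserted graph acts on the rest of the network like a single resistor of
  resistance \<open>L\<close>, so the Green kernel after replacement is the interpolated kernel of \<open>\<Gamma>\<close> plus the
  kernels of the inserted graphs with \<open>p\<close> and \<open>q\<close> grounded. The formula then comes down to one
  identity for each inserted graph, and \<open>F/L = 1/(L + R)\<close> brings in $R_i$.
\<close>

section \<open>The Dirichlet form and its Green kernel\<close>

text \<open>The definitions speak of functions on all points, through one-sided derivatives and
  definite descriptions, whereas the algebra wants finitely many unknowns. The bridge is that a unit
  potential is fixed by its vertex values: on every edge it is their linear interpolation plus an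
  explicit tent for each terminal inside that edge. Terminals inside edges cannot be avoided:
  \<open>tau\<close> quantifies over all poles, and \<open>A_const\<close> moves the sink along the
  edges. Why an inserted graph acts like one resistor: the potential driven through it from
  \<open>q\<close> to \<open>p\<close> pairs with any \<open>f\<close> to \<open>f q - f p\<close>.
  Energies of extended functions therefore collapse to energies on \<Gamma>, and whatever vanishes
  at both \<open>p\<close> and \<open>q\<close> is orthogonal to the extensions. Loops
  (\<open>r = 0\<close>, \<open>F = 1\<close>) and bridges (\<open>r = L\<close>,
  \<open>F = 0\<close>) are covered by the same computation.\<close>

lemma connected_iff_edge_invariant_constant:
  assumes "wf_digraph D"
  shows "Digraph_Component.connected D \<longleftrightarrow> verts D \<noteq> {} \<and>
    (\<forall>f::'v \<Rightarrow> real. (\<forall>e\<in>arcs D. f (tail D e) = f (head D e)) \<longrightarrow>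
       (\<forall>u\<in>verts D. \<forall>v\<in>verts D. f u = f v))"
    (is "_ \<longleftrightarrow> _ \<and> ?inv")
proof -
  interpret wf_digraph D by fact
  let ?M = "with_proj (mk_symmetric D)"
  have ends: "arcs_ends ?M = (\<Union>e\<in>arcs D. {(tail D e, head D e), (head D e, tail D e)})"
    by (auto simp: arcs_ends_conv parcs_mk_symmetric)
  have vs: "verts ?M = verts D"
    by (simp add: mk_symmetric_def)
  have inv: "f u = f v"
    if "u \<rightarrow>\<^sup>*\<^bsub>?M\<^esub> v" and f: "\<And>e. e \<in> arcs D \<Longrightarrow> f (tail D e) = f (head D e)"
    for u v and f :: "'v \<Rightarrow> real"
    using that(1) unfolding reachable_def
    by (induct rule: rtrancl_on_induct) (use f in \<open>auto simp: parcs_mk_symmetric\<close>)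
  have reach: "u \<rightarrow>\<^sup>*\<^bsub>?M\<^esub> v" if "?inv" "u \<in> verts D" "v \<in> verts D" for u v
  proof -
    \<comment> \<open>The indicator of the set reached from \<open>u\<close> takes equal values at
      the ends of every edge. Real-valued functions are used because constancy is later applied to
      functions of zero energy.\<close>
    define f where "f x = (if u \<rightarrow>\<^sup>*\<^bsub>?M\<^esub> x then 1 else 0 :: real)" for x
    have step: "u \<rightarrow>\<^sup>*\<^bsub>?M\<^esub> b" if "u \<rightarrow>\<^sup>*\<^bsub>?M\<^esub> a" "(a, b) \<in> arcs_ends ?M" "a \<in> verts D" "b \<in> verts D" for a b
      using that unfolding reachable_def
      by (auto intro: rtrancl_on_into_rtrancl_on simp: vs)
    have "f (tail D e) = f (head D e)" if "e \<in> arcs D" for e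
      using that step[of "tail D e" "head D e"] step[of "head D e" "tail D e"]
      unfolding f_def ends by auto
    then have "f u = f v" using that by blast
    moreover have "f u = 1"
      using that by (auto simp: f_def reachable_def vs)
    ultimately show ?thesis by (auto simp: f_def split: if_splits)
  qed
  have "(\<forall>u\<in>verts D. \<forall>v\<in>verts D. u \<rightarrow>\<^sup>*\<^bsub>?M\<^esub> v) \<longleftrightarrow> ?inv"
  proof
    assume all: "\<forall>u\<in>verts D. \<forall>v\<in>verts D. u \<rightarrow>\<^sup>*\<^bsub>?M\<^esub> v"
    show ?inv
    proof (intro allI impI ballI)
      fix f :: "'v \<Rightarrow> real" and u v
      assume "\<forall>e\<in>arcs D. f (tail D e) = f (head D e)" and "u \<in> verts D" "v \<in> verts D"
      then show "f u = f v" using all by (intro inv[of u v f]) blast+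
    qed
  next
    assume ?inv
    then show "\<forall>u\<in>verts D. \<forall>v\<in>verts D. u \<rightarrow>\<^sup>*\<^bsub>?M\<^esub> v" by (intro ballI reach)
  qed
  then show ?thesis
    unfolding connected_def strongly_connected_def vs by simp
qed

text \<open>Each edge enters through a product of two differences, so its orientation is immaterial
  and a loop contributes 0.\<close>

definition energy :: "('v, 'e) mgraph \<Rightarrow> ('v \<Rightarrow> real) \<Rightarrow> ('v \<Rightarrow> real) \<Rightarrow> real" where
  "energy G f g =
     (\<Sum>e\<in>edges G. (f (tgt G e) - f (src G e)) * (g (tgt G e) - g (src G e)) / len G e)"

lemma energy_commute: "energy G f g = energy G g f"
  by (simp add: energy_def mult.commute)

lemma energy_add_left: "energy G (\<lambda>x. f x + g x) h = energy G f h + energy G g h"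
  unfolding energy_def sum.distrib[symmetric]
  by (rule sum.cong) (auto simp: algebra_simps add_divide_distrib diff_divide_distrib)

lemma energy_diff_left: "energy G (\<lambda>x. f x - g x) h = energy G f h - energy G g h"
  unfolding energy_def sum_subtractf[symmetric]
  by (rule sum.cong) (auto simp: algebra_simps add_divide_distrib diff_divide_distrib)

lemma energy_scale_left: "energy G (\<lambda>x. c * f x) h = c * energy G f h"
  unfolding energy_def sum_distrib_left
  by (rule sum.cong) (auto simp: algebra_simps add_divide_distrib diff_divide_distrib)

lemma energy_const_left: "energy G (\<lambda>x. c) h = 0"
  by (simp add: energy_def)

lemma energy_sum_left:
  "finite A \<Longrightarrow> energy G (\<lambda>x. \<Sum>a\<in>A. f a x) h = (\<Sum>a\<in>A. energy G (f a) h)"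
  by (induct A rule: finite_induct) (simp_all add: energy_const_left energy_add_left)

lemma energy_add_right: "energy G h (\<lambda>x. f x + g x) = energy G h f + energy G h g"
  by (metis energy_add_left energy_commute)

lemma energy_diff_right: "energy G h (\<lambda>x. f x - g x) = energy G h f - energy G h g"
  by (metis energy_diff_left energy_commute)

lemma energy_scale_right: "energy G h (\<lambda>x. c * f x) = c * energy G h f"
  by (metis energy_scale_left energy_commute)

lemma energy_const_right: "energy G h (\<lambda>x. c) = 0"
  by (metis energy_const_left energy_commute)

lemma energy_sum_right:
  "finite A \<Longrightarrow> energy G h (\<lambda>x. \<Sum>a\<in>A. f a x) = (\<Sum>a\<in>A. energy G h (f a))"
  using energy_sum_left[of A G f h] by (simp add: energy_commute)

lemmas energy_linear = energy_add_left energy_diff_left energy_scale_left energy_const_left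
  energy_add_right energy_diff_right energy_scale_right energy_const_right

locale metrized =
  fixes G :: "('v, 'e) mgraph"
  assumes metrized: "metrized_graph G"
begin

lemma finite_edges [simp]: "finite (edges G)"
  and finite_vertices [simp]: "finite (vertices G)"
  and src_in [simp]: "e \<in> edges G \<Longrightarrow> src G e \<in> vertices G"
  and tgt_in [simp]: "e \<in> edges G \<Longrightarrow> tgt G e \<in> vertices G"
proof -
  interpret fin_digraph "skel G" using metrized by (simp add: metrized_graph_def)
  show "finite (edges G)" "finite (vertices G)"
    "e \<in> edges G \<Longrightarrow> src G e \<in> vertices G" "e \<in> edges G \<Longrightarrow> tgt G e \<in> vertices G"
    by simp_all
qed

lemma len_pos: "e \<in> edges G \<Longrightarrow> 0 < len G e"
  using metrized by (simp add: metrized_graph_def)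

lemma len_nonzero [simp]: "e \<in> edges G \<Longrightarrow> len G e \<noteq> 0"
  using len_pos[of e] by simp

lemma
  shows vertices_nonempty: "vertices G \<noteq> {}"
    and edge_invariant_constant:
      "\<And>f::'v \<Rightarrow> real. (\<And>e. e \<in> edges G \<Longrightarrow> f (src G e) = f (tgt G e)) \<Longrightarrow>
         u \<in> vertices G \<Longrightarrow> v \<in> vertices G \<Longrightarrow> f u = f v"
proof -
  have "wf_digraph (skel G)" "Digraph_Component.connected (skel G)"
    using metrized by (auto simp: metrized_graph_def fin_digraph_def)
  note c = this(2)[unfolded connected_iff_edge_invariant_constant[OF this(1)]]
  show "vertices G \<noteq> {}" using c by blast
  show "\<And>f::'v \<Rightarrow> real. (\<And>e. e \<in> edges G \<Longrightarrow> f (src G e) = f (tgt G e)) \<Longrightarrow>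
         u \<in> vertices G \<Longrightarrow> v \<in> vertices G \<Longrightarrow> f u = f v"
    using c by blast
qed

lemma energy_cong:
  assumes "\<And>v. v \<in> vertices G \<Longrightarrow> f v = f' v" "\<And>v. v \<in> vertices G \<Longrightarrow> g v = g' v"
  shows "energy G f g = energy G f' g'"
  unfolding energy_def by (rule sum.cong) (auto simp: assms)

lemma energy_nonneg: "0 \<le> energy G f f"
  unfolding energy_def by (intro sum_nonneg divide_nonneg_nonneg) (auto simp: less_imp_le len_pos)

lemma energy_eq_0_edge:
  assumes "energy G f f = 0" "e \<in> edges G"
  shows "f (src G e) = f (tgt G e)"
proof -
  have "\<forall>e\<in>edges G. (f (tgt G e) - f (src G e)) * (f (tgt G e) - f (src G e)) / len G e = 0"
    using assms(1) unfolding energy_def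
    by (subst (asm) sum_nonneg_eq_0_iff) (auto simp: less_imp_le len_pos)
  then show ?thesis using assms(2) by auto
qed

lemma energy_eq_0_constant:
  "energy G f f = 0 \<Longrightarrow> u \<in> vertices G \<Longrightarrow> v \<in> vertices G \<Longrightarrow> f u = f v"
  using energy_eq_0_edge edge_invariant_constant[of f] by blast

abbreviation delta :: "'v \<Rightarrow> 'v \<Rightarrow> real" where "delta v \<equiv> (\<lambda>x. of_bool (x = v))"

text \<open>A test function supported in \<open>U\<close> is a finite combination of point masses;
  this passes from equations at single vertices to arbitrary test functions.\<close>

lemma energy_expand:
  assumes "finite U" "\<And>v. v \<in> vertices G - U \<Longrightarrow> \<phi> v = 0"
  shows "energy G f \<phi> = (\<Sum>v\<in>U. \<phi> v * energy G f (delta v))"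
proof -
  have "energy G f \<phi> = energy G f (\<lambda>x. \<Sum>v\<in>U. \<phi> v * delta v x)"
    by (rule energy_cong) (use assms in \<open>auto simp: of_bool_def if_distrib cong: if_cong\<close>)
  also have "\<dots> = (\<Sum>v\<in>U. \<phi> v * energy G f (delta v))"
    by (subst energy_sum_right[OF assms(1)]) (simp only: energy_scale_right)
  finally show ?thesis .
qed

text \<open>Free vertices are added one at a time; the pivot \<open>energy G f1 f1\<close> is positive
  because \<open>f1\<close> takes the values 1 and 0.\<close>

lemma dirichlet_problem:
  assumes "z \<in> vertices G" "finite U" "U \<subseteq> vertices G - {z}"
  shows "\<exists>f. (\<forall>x. x \<notin> U \<longrightarrow> f x = 0) \<and> (\<forall>v\<in>U. energy G f (delta v) = h v)"
  using assms(2,3)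
proof (induct U arbitrary: h rule: finite_induct)
  case empty
  show ?case by (rule exI[of _ "\<lambda>_. 0"]) simp
next
  case (insert u U)
  have U: "U \<subseteq> vertices G - {z}" and u: "u \<in> vertices G" "u \<noteq> z" using insert.prems by auto
  obtain f0 where f0: "\<And>x. x \<notin> U \<Longrightarrow> f0 x = 0" "\<And>v. v \<in> U \<Longrightarrow> energy G f0 (delta v) = h v"
    using insert.hyps(3)[OF U, of h] by metis
  obtain f' where
    f': "\<And>x. x \<notin> U \<Longrightarrow> f' x = 0" "\<And>v. v \<in> U \<Longrightarrow> energy G f' (delta v) = energy G (delta u) (delta v)"
    using insert.hyps(3)[OF U, of "\<lambda>v. energy G (delta u) (delta v)"] by metis
  \<comment> \<open>The point mass at \<open>u\<close>, corrected inside \<open>U\<close> so that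
    its pairings there vanish: adding a multiple of it changes the equation at \<open>u\<close> and
    keeps those already solved.\<close>
  define f1 where "f1 = (\<lambda>x. delta u x - f' x)"
  have f1U: "energy G f1 (delta v) = 0" if "v \<in> U" for v
    using f'(2)[OF that] by (simp add: f1_def energy_diff_left)
  have "energy G f1 f' = (\<Sum>v\<in>U. f' v * energy G f1 (delta v))"
    by (rule energy_expand) (use insert.hyps(1) f'(1) in auto)
  then have "energy G f1 f' = 0" using f1U by simp
  then have piv: "energy G f1 f1 = energy G f1 (delta u)"
    by (subst (2) f1_def) (simp add: energy_diff_right)
  have "f1 u = 1" "f1 z = 0" using insert.hyps(2) f'(1) U u by (auto simp: f1_def)
  then have piv0: "energy G f1 (delta u) \<noteq> 0"
    using energy_eq_0_constant[of f1 u z] u assms(1) piv by auto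
  define c where "c = (h u - energy G f0 (delta u)) / energy G f1 (delta u)"
  show ?case
  proof (rule exI[of _ "\<lambda>x. f0 x + c * f1 x"], intro conjI allI impI ballI)
    show "f0 x + c * f1 x = 0" if "x \<notin> insert u U" for x
      using that f0(1) f'(1) by (auto simp: f1_def)
    show "energy G (\<lambda>x. f0 x + c * f1 x) (delta v) = h v" if "v \<in> insert u U" for v
      unfolding energy_add_left energy_scale_left
      using that f0(2) f1U piv0 by (auto simp: c_def)
  qed
qed

end

text \<open>The weak form of the potential for unit current entering at \<open>y\<close> and leaving
  at the grounded vertex \<open>z\<close>. As a reproducing property against all test functions it
  evaluates any energy that contains a column of \<open>g\<close>.\<close>

definition green_kernel :: "('v, 'e) mgraph \<Rightarrow> 'v \<Rightarrow> ('v \<Rightarrow> 'v \<Rightarrow> real) \<Rightarrow> bool" where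
  "green_kernel G z g \<longleftrightarrow> z \<in> vertices G \<and> (\<forall>y\<in>vertices G. g z y = 0 \<and>
     (\<forall>\<phi>. energy G (\<lambda>x. g x y) \<phi> = \<phi> y - \<phi> z))"

lemma green_kernelD:
  assumes "green_kernel G z g"
  shows "z \<in> vertices G" "y \<in> vertices G \<Longrightarrow> g z y = 0"
    "y \<in> vertices G \<Longrightarrow> energy G (\<lambda>x. g x y) \<phi> = \<phi> y - \<phi> z"
    "y \<in> vertices G \<Longrightarrow> energy G \<phi> (\<lambda>x. g x y) = \<phi> y - \<phi> z"
  using assms by (auto simp: green_kernel_def energy_commute)

text \<open>The pairing of the columns with poles \<open>x\<close> and \<open>y\<close> can be
  evaluated by reproducing with either of them.\<close>

lemma green_kernel_sym:
  assumes "green_kernel G z g" "x \<in> vertices G" "y \<in> vertices G"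
  shows "g x y = g y x"
  using green_kernelD(3)[OF assms(1,2), of "\<lambda>v. g v y"] green_kernelD(4)[OF assms(1,3), of "\<lambda>v. g v x"]
    green_kernelD(2)[OF assms(1)] assms by simp

lemma (in metrized) green_kernel_exists:
  assumes "z \<in> vertices G"
  obtains g where "green_kernel G z g"
proof -
  have "\<exists>f. f z = 0 \<and> (\<forall>\<phi>. energy G f \<phi> = \<phi> y - \<phi> z)" if "y \<in> vertices G" for y
  proof -
    let ?U = "vertices G - {z}"
    obtain f where f: "\<And>x. x \<notin> ?U \<Longrightarrow> f x = 0"
      "\<And>v. v \<in> ?U \<Longrightarrow> energy G f (delta v) = of_bool (v = y)"
      using dirichlet_problem[OF assms, of ?U "\<lambda>v. of_bool (v = y)"] by auto
    have "energy G f \<phi> = \<phi> y - \<phi> z" for \<phi>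
    proof -
      \<comment> \<open>Constants have no energy, so the test function may be shifted to vanish at
        \<open>z\<close>, the one vertex where no equation was imposed on \<open>f\<close>.\<close>
      have "energy G f \<phi> = energy G f (\<lambda>x. \<phi> x - \<phi> z)"
        by (simp add: energy_linear)
      also have "\<dots> = (\<Sum>v\<in>?U. (\<phi> v - \<phi> z) * energy G f (delta v))"
        by (rule energy_expand) auto
      also have "\<dots> = (\<Sum>v\<in>?U. if v = y then \<phi> y - \<phi> z else 0)"
        by (rule sum.cong) (auto simp: f(2))
      also have "\<dots> = \<phi> y - \<phi> z" using that by auto
      finally show ?thesis .
    qed
    then show ?thesis using f(1)[of z] by auto
  qed
  then obtain F where "\<And>y. y \<in> vertices G \<Longrightarrow> F y z = 0 \<and> (\<forall>\<phi>. energy G (F y) \<phi> = \<phi> y - \<phi> z)"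
    by metis
  then have "green_kernel G z (\<lambda>x y. F y x)"
    using assms by (auto simp: green_kernel_def)
  then show ?thesis by (rule that)
qed

text \<open>The diagonal value is the energy of the column with pole \<open>y\<close>. Were it 0,
  every pairing with that column would vanish, but the one with the point mass at \<open>y\<close>
  is 1.\<close>

lemma (in metrized) green_kernel_diag_pos:
  assumes g: "green_kernel G z g" and "y \<in> vertices G" "y \<noteq> z"
  shows "0 < g y y"
proof -
  let ?f = "\<lambda>x. g x y"
  have e: "energy G ?f ?f = g y y"
    using green_kernelD(2,3)[OF g] assms(2) by simp
  have "energy G ?f (delta y) = 1"
    using green_kernelD(3)[OF g] assms by simp
  moreover have "energy G ?f (delta y) = 0" if "energy G ?f ?f = 0"
    unfolding energy_def using energy_eq_0_edge[OF that] by (intro sum.neutral) simp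
  ultimately have "g y y \<noteq> 0" using e by fastforce
  then show ?thesis using energy_nonneg[of ?f] e by simp
qed

section \<open>Potentials on the metric graph\<close>

lemma vector_derivative_right_affine:
  fixes F :: "real \<Rightarrow> real"
  assumes "t < b" "b \<le> L" "\<And>r. r \<in> {t..b} \<Longrightarrow> F r = F t + c * (r - t)"
  shows "vector_derivative F (at t within {t..L}) = c"
proof (rule vector_derivative_within_closed_interval)
  have "((\<lambda>r. F t + c * (r - t)) has_vector_derivative c) (at t within {t..b})"
    by (auto intro!: derivative_eq_intros)
  then have "(F has_vector_derivative c) (at t within {t..b})"
    by (rule has_vector_derivative_transform[rotated -1]) (use assms(1,2) in simp, rule assms(3))
  \<comment> \<open>Only the germ to the right of \<open>t\<close> matters, so affinity on a short
    piece determines the derivative within the whole remaining edge.\<close>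
  moreover have "at t within {t..b} = at t within {t..L}"
    using assms(1,2) at_within_Icc_at_right[of t b] at_within_Icc_at_right[of t L] by simp
  ultimately show "(F has_vector_derivative c) (at t within {t..L})" by simp
qed (use assms(1,2) in auto)

lemma vector_derivative_left_affine:
  fixes F :: "real \<Rightarrow> real"
  assumes "a < t" "0 \<le> a" "\<And>r. r \<in> {a..t} \<Longrightarrow> F r = F t + c * (r - t)"
  shows "vector_derivative F (at t within {0..t}) = c"
proof (rule vector_derivative_within_closed_interval)
  have "((\<lambda>r. F t + c * (r - t)) has_vector_derivative c) (at t within {a..t})"
    by (auto intro!: derivative_eq_intros)
  then have "(F has_vector_derivative c) (at t within {a..t})"
    by (rule has_vector_derivative_transform[rotated -1]) (use assms(1,2) in simp, rule assms(3))
  moreover have "at t within {a..t} = at t within {0..t}"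
    using assms(1,2) at_within_Icc_at_left[of a t] at_within_Icc_at_left[of 0 t] by simp
  ultimately show "(F has_vector_derivative c) (at t within {0..t})" by simp
qed (use assms(1,2) in auto)

text \<open>Break points are removed one at a time: the two pieces meeting at \<open>s\<close> have
  the one-sided derivatives as slopes, these agree, and the pieces merge.\<close>

lemma affine_if_piecewise_affine_no_kink:
  fixes F :: "real \<Rightarrow> real"
  assumes "finite S"
    and "\<And>a b. 0 \<le> a \<Longrightarrow> a < b \<Longrightarrow> b \<le> L \<Longrightarrow> {a<..<b} \<inter> S = {} \<Longrightarrow>
           \<exists>c. \<forall>t\<in>{a..b}. F t = F a + c * (t - a)"
    and "\<And>s. s \<in> S \<Longrightarrow> 0 < s \<Longrightarrow> s < L \<Longrightarrow>
           vector_derivative F (at s within {s..L}) = vector_derivative F (at s within {0..s})"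
    and "0 \<le> a" "a < b" "b \<le> L"
  shows "\<exists>c. \<forall>t\<in>{a..b}. F t = F a + c * (t - a)"
  using assms
proof (induct S arbitrary: a b rule: finite_induct)
  case empty
  then show ?case by simp
next
  case (insert s S)
  show ?case
  proof (rule insert.hyps(3))
    fix a b :: real
    assume ab: "0 \<le> a" "a < b" "b \<le> L" "{a<..<b} \<inter> S = {}"
    show "\<exists>c. \<forall>t\<in>{a..b}. F t = F a + c * (t - a)"
    proof (cases "s \<in> {a<..<b}")
      case False
      then show ?thesis using ab insert.prems(1)[of a b] by simp
    next
      case True
      have "{a<..<s} \<inter> insert s S = {}" "{s<..<b} \<inter> insert s S = {}"
        using ab(4) True by (auto simp: set_eq_iff)
      note disj = this
      have "\<exists>c. \<forall>t\<in>{a..s}. F t = F a + c * (t - a)"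
        by (rule insert.prems(1)) (use True ab disj in auto)
      then obtain c where c: "\<And>t. t \<in> {a..s} \<Longrightarrow> F t = F a + c * (t - a)" by blast
      have "\<exists>c. \<forall>t\<in>{s..b}. F t = F s + c * (t - s)"
        by (rule insert.prems(1)) (use True ab disj in auto)
      then obtain d where d: "\<And>t. t \<in> {s..b} \<Longrightarrow> F t = F s + d * (t - s)" by blast
      have Fs: "F s = F a + c * (s - a)" using c[of s] True by simp
      have "vector_derivative F (at s within {s..L}) = d"
        by (rule vector_derivative_right_affine[OF _ ab(3) d]) (use True in simp)
      moreover have "vector_derivative F (at s within {0..s}) = c"
      proof (rule vector_derivative_left_affine[where a = a])
        show "F r = F s + c * (r - s)" if "r \<in> {a..s}" for r
          unfolding c[OF that] Fs by (simp add: algebra_simps)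
      qed (use True ab in auto)
      ultimately have "d = c"
        using insert.prems(2)[of s] True ab by simp
      have "F t = F a + c * (t - a)" if "t \<in> {a..b}" for t
      proof (cases "t \<le> s")
        case True
        then show ?thesis by (intro c) (use that in simp)
      next
        case False
        then have "F t = F s + d * (t - s)" by (intro d) (use that in simp)
        then show ?thesis unfolding Fs \<open>d = c\<close> by (simp add: algebra_simps)
      qed
      then show ?thesis by blast
    qed
  qed (use insert.prems in auto)
qed

section \<open>Explicit form of potentials along the edges\<close>

definition interp :: "('v, 'e) mgraph \<Rightarrow> ('v \<Rightarrow> real) \<Rightarrow> ('v, 'e) gpoint \<Rightarrow> real" where
  "interp G f x = (case x of Vertex v \<Rightarrow> f v
     | Inner e t \<Rightarrow> f (src G e) + (f (tgt G e) - f (src G e)) * t / len G e)"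

text \<open>The Green function with pole \<open>x\<close> of the interval \<open>e\<close> with both end points grounded.\<close>

definition tent :: "('v, 'e) mgraph \<Rightarrow> 'e \<Rightarrow> ('v, 'e) gpoint \<Rightarrow> real \<Rightarrow> real" where
  "tent G e x t = (case x of Vertex _ \<Rightarrow> 0
     | Inner e' s \<Rightarrow> if e' = e then min t s - t * s / len G e else 0)"

text \<open>The slope of \<open>tent\<close> to the right of \<open>t\<close>; its left counterpart
  \<open>tent_bwd\<close> has \<open>t \<le> s\<close> in place of \<open>t < s\<close>, which
  encodes the unit jump of the slope at the pole.\<close>

definition tent_fwd :: "('v, 'e) mgraph \<Rightarrow> 'e \<Rightarrow> ('v, 'e) gpoint \<Rightarrow> real \<Rightarrow> real" where
  "tent_fwd G e x t = (case x of Vertex _ \<Rightarrow> 0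
     | Inner e' s \<Rightarrow> if e' = e then of_bool (t < s) - s / len G e else 0)"

definition tent_bwd :: "('v, 'e) mgraph \<Rightarrow> 'e \<Rightarrow> ('v, 'e) gpoint \<Rightarrow> real \<Rightarrow> real" where
  "tent_bwd G e x t = (case x of Vertex _ \<Rightarrow> 0
     | Inner e' s \<Rightarrow> if e' = e then of_bool (t \<le> s) - s / len G e else 0)"

text \<open>The shape forced by Ohm's law on the edges together with Kirchhoff's law at interior
  points. The values at the vertices remain free.\<close>

definition edgewise_potential ::
  "('v, 'e) mgraph \<Rightarrow> ('v, 'e) gpoint \<Rightarrow> ('v, 'e) gpoint \<Rightarrow> (('v, 'e) gpoint \<Rightarrow> real) \<Rightarrow> bool" where
  "edgewise_potential G y z f \<longleftrightarrow> (\<forall>e\<in>edges G. \<forall>t\<in>{0..len G e}. f (pt G e t) =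
     interp G (\<lambda>v. f (Vertex v)) (pt G e t) + tent G e y t - tent G e z t)"

text \<open>For a Green kernel \<open>g\<close> of the vertices this is the Green kernel of the
  metric graph. Interpolation in both arguments creates no source inside an edge; the tent supplies
  it.\<close>

definition point_kernel ::
  "('v, 'e) mgraph \<Rightarrow> ('v \<Rightarrow> 'v \<Rightarrow> real) \<Rightarrow> ('v, 'e) gpoint \<Rightarrow> ('v, 'e) gpoint \<Rightarrow> real" where
  "point_kernel G g x y = interp G (\<lambda>a. interp G (g a) y) x +
     (case x of Vertex _ \<Rightarrow> 0 | Inner e t \<Rightarrow> tent G e y t)"

context metrized
begin

lemma Vertex_in_points [simp]: "Vertex v \<in> points G \<longleftrightarrow> v \<in> vertices G"
  and Inner_in_points [simp]: "Inner e t \<in> points G \<longleftrightarrow> e \<in> edges G \<and> 0 < t \<and> t < len G e"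
  by (auto simp: points_def)

lemma pt_in_points [simp]: "e \<in> edges G \<Longrightarrow> pt G e t \<in> points G"
  by (auto simp: pt_def)

lemma pt_simps:
  "pt G e 0 = Vertex (src G e)"
  "e \<in> edges G \<Longrightarrow> pt G e (len G e) = Vertex (tgt G e)"
  "0 < t \<Longrightarrow> t < len G e \<Longrightarrow> pt G e t = Inner e t"
  using len_pos[of e] by (auto simp: pt_def)

lemma interp_pt:
  "e \<in> edges G \<Longrightarrow> t \<in> {0..len G e} \<Longrightarrow>
     interp G f (pt G e t) = f (src G e) + (f (tgt G e) - f (src G e)) * t / len G e"
  by (auto simp: pt_def interp_def)

lemma tent_ends:
  assumes "x \<in> points G" "e \<in> edges G"
  shows "tent G e x 0 = 0" "tent G e x (len G e) = 0"
  using assms by (auto simp: tent_def split: gpoint.splits)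

lemma point_kernel_pt:
  assumes "e \<in> edges G" "t \<in> {0..len G e}" "y \<in> points G"
  shows "point_kernel G g (pt G e t) y = interp G (\<lambda>a. interp G (g a) y) (pt G e t) + tent G e y t"
proof -
  consider "t = 0" | "t = len G e" | "0 < t" "t < len G e" using assms by fastforce
  then show ?thesis
    by cases (use assms in \<open>auto simp: pt_simps point_kernel_def tent_ends\<close>)
qed

lemma tent_affine_segment:
  assumes "e \<in> edges G" "y \<in> points G" "0 \<le> a" "a < b" "b \<le> len G e"
    and "\<And>t. t \<in> {a<..<b} \<Longrightarrow> pt G e t \<noteq> y"
  shows "\<exists>c. \<forall>t\<in>{a..b}. tent G e y t = tent G e y a + c * (t - a)"
proof (cases "\<exists>s. y = Inner e s")
  case True
  then obtain s where s: "y = Inner e s" by blast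
  have "\<not> (a < s \<and> s < b)"
    using assms(6)[of s] assms(2,3,5) s pt_simps(3)[of s e] by auto
  then consider "s \<le> a" | "b \<le> s" by linarith
  then show ?thesis
  proof cases
    case 1
    then have "\<forall>t\<in>{a..b}. tent G e y t = tent G e y a + (- s / len G e) * (t - a)"
      using assms(1) by (auto simp: s tent_def min_def field_simps)
    then show ?thesis by blast
  next
    case 2
    then have "\<forall>t\<in>{a..b}. tent G e y t = tent G e y a + (1 - s / len G e) * (t - a)"
      using assms(1) by (auto simp: s tent_def min_def field_simps)
    then show ?thesis by blast
  qed
next
  case False
  then have "\<forall>t\<in>{a..b}. tent G e y t = tent G e y a + 0 * (t - a)"
    by (auto simp: tent_def split: gpoint.splits)
  then show ?thesis by blast
qed

lemma tent_affine_right: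
  assumes "e \<in> edges G" "y \<in> points G" "0 \<le> t" "t < len G e"
  shows "\<exists>b>t. b \<le> len G e \<and> (\<forall>r\<in>{t..b}. tent G e y r = tent G e y t + tent_fwd G e y t * (r - t))"
proof (cases "\<exists>s. y = Inner e s \<and> t < s")
  case True
  then obtain s where "y = Inner e s" "t < s" by blast
  then show ?thesis using assms
    by (intro exI[of _ s]) (auto simp: tent_def tent_fwd_def min_def field_simps)
next
  case False
  then show ?thesis using assms
    by (intro exI[of _ "len G e"])
      (auto simp: tent_def tent_fwd_def min_def field_simps split: gpoint.splits)
qed

lemma tent_affine_left:
  assumes "e \<in> edges G" "y \<in> points G" "0 < t" "t \<le> len G e"
  shows "\<exists>b<t. 0 \<le> b \<and> (\<forall>r\<in>{b..t}. tent G e y r = tent G e y t + tent_bwd G e y t * (r - t))"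
proof (cases "\<exists>s. y = Inner e s \<and> s < t")
  case True
  then obtain s where "y = Inner e s" "s < t" by blast
  then show ?thesis using assms
    by (intro exI[of _ s]) (auto simp: tent_def tent_bwd_def min_def field_simps)
next
  case False
  then show ?thesis using assms
    by (intro exI[of _ 0])
      (auto simp: tent_def tent_bwd_def min_def field_simps split: gpoint.splits)
qed

lemma current_fwd_edgewise:
  assumes "edgewise_potential G y z f" "y \<in> points G" "z \<in> points G"
    and e: "e \<in> edges G" and t: "0 \<le> t" "t < len G e"
  shows "current_fwd G f e t =
    - ((f (Vertex (tgt G e)) - f (Vertex (src G e))) / len G e + tent_fwd G e y t - tent_fwd G e z t)"
proof -
  obtain b where b: "t < b" "b \<le> len G e"
    "\<And>r. r \<in> {t..b} \<Longrightarrow> tent G e y r = tent G e y t + tent_fwd G e y t * (r - t)"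
    using tent_affine_right[OF e assms(2) t] by blast
  obtain b' where b': "t < b'" "b' \<le> len G e"
    "\<And>r. r \<in> {t..b'} \<Longrightarrow> tent G e z r = tent G e z t + tent_fwd G e z t * (r - t)"
    using tent_affine_right[OF e assms(3) t] by blast
  let ?c = "(f (Vertex (tgt G e)) - f (Vertex (src G e))) / len G e + tent_fwd G e y t - tent_fwd G e z t"
  have f: "f (pt G e r) = f (Vertex (src G e)) +
      (f (Vertex (tgt G e)) - f (Vertex (src G e))) * r / len G e + tent G e y r - tent G e z r"
    if "r \<in> {0..len G e}" for r
    using assms(1) e that by (auto simp: edgewise_potential_def interp_pt)
  have "vector_derivative (\<lambda>r. f (pt G e r)) (at t within {t..len G e}) = ?c"
  proof (rule vector_derivative_right_affine[where b = "min b b'"])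
    show "f (pt G e r) = f (pt G e t) + ?c * (r - t)" if r: "r \<in> {t..min b b'}" for r
    proof -
      have "tent G e y r = tent G e y t + tent_fwd G e y t * (r - t)"
        "tent G e z r = tent G e z t + tent_fwd G e z t * (r - t)"
        by (rule b(3) b'(3), use r in simp)+
      moreover have "f (pt G e r) - tent G e y r + tent G e z r =
          f (pt G e t) - tent G e y t + tent G e z t +
          (f (Vertex (tgt G e)) - f (Vertex (src G e))) / len G e * (r - t)"
      proof -
        have rt: "r \<in> {0..len G e}" "t \<in> {0..len G e}" using r t b b' by auto
        show ?thesis
          unfolding f[OF rt(1)] f[OF rt(2)]
          by (simp add: right_diff_distrib left_diff_distrib diff_divide_distrib)
      qed
      ultimately show ?thesis unfolding ring_distribs by linarith
    qed
  qed (use b(1,2) b'(1,2) in auto)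
  then show ?thesis by (simp add: current_fwd_def)
qed

lemma current_bwd_edgewise:
  assumes "edgewise_potential G y z f" "y \<in> points G" "z \<in> points G"
    and e: "e \<in> edges G" and t: "0 < t" "t \<le> len G e"
  shows "current_bwd G f e t =
    (f (Vertex (tgt G e)) - f (Vertex (src G e))) / len G e + tent_bwd G e y t - tent_bwd G e z t"
proof -
  obtain b where b: "b < t" "0 \<le> b"
    "\<And>r. r \<in> {b..t} \<Longrightarrow> tent G e y r = tent G e y t + tent_bwd G e y t * (r - t)"
    using tent_affine_left[OF e assms(2) t] by blast
  obtain b' where b': "b' < t" "0 \<le> b'"
    "\<And>r. r \<in> {b'..t} \<Longrightarrow> tent G e z r = tent G e z t + tent_bwd G e z t * (r - t)"
    using tent_affine_left[OF e assms(3) t] by blast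
  let ?c = "(f (Vertex (tgt G e)) - f (Vertex (src G e))) / len G e + tent_bwd G e y t - tent_bwd G e z t"
  have f: "f (pt G e r) = f (Vertex (src G e)) +
      (f (Vertex (tgt G e)) - f (Vertex (src G e))) * r / len G e + tent G e y r - tent G e z r"
    if "r \<in> {0..len G e}" for r
    using assms(1) e that by (auto simp: edgewise_potential_def interp_pt)
  have "vector_derivative (\<lambda>r. f (pt G e r)) (at t within {0..t}) = ?c"
  proof (rule vector_derivative_left_affine[where a = "max b b'"])
    show "f (pt G e r) = f (pt G e t) + ?c * (r - t)" if r: "r \<in> {max b b'..t}" for r
    proof -
      have "tent G e y r = tent G e y t + tent_bwd G e y t * (r - t)"
        "tent G e z r = tent G e z t + tent_bwd G e z t * (r - t)"
        by (rule b(3) b'(3), use r in simp)+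
      moreover have "f (pt G e r) - tent G e y r + tent G e z r =
          f (pt G e t) - tent G e y t + tent G e z t +
          (f (Vertex (tgt G e)) - f (Vertex (src G e))) / len G e * (r - t)"
      proof -
        have rt: "r \<in> {0..len G e}" "t \<in> {0..len G e}" using r t b b' by auto
        show ?thesis
          unfolding f[OF rt(1)] f[OF rt(2)]
          by (simp add: right_diff_distrib left_diff_distrib diff_divide_distrib)
      qed
      ultimately show ?thesis unfolding ring_distribs by linarith
    qed
  qed (use b(1,2) b'(1,2) in auto)
  then show ?thesis by (simp add: current_bwd_def)
qed

lemma tent_slope_jump:
  assumes "y \<in> points G"
  shows "tent_bwd G e y t - tent_fwd G e y t = of_bool (Inner e t = y)"
  using assms by (auto simp: tent_bwd_def tent_fwd_def split: gpoint.splits)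

text \<open>A unit source at parameter \<open>s\<close> inside an edge sends the currents
  \<open>1 - s / L\<close> and \<open>s / L\<close> to its two ends, which are the interpolation
  weights of \<open>delta v\<close>. The \<open>of_bool\<close> term cancels that weight when
  \<open>y\<close> is itself a vertex and has no tent.\<close>

lemma tent_slopes_at_vertex:
  assumes "y \<in> points G"
  shows "(\<Sum>e\<in>edges G. of_bool (src G e = v) * tent_fwd G e y 0 - of_bool (tgt G e = v) * tent_bwd G e y (len G e))
     = interp G (delta v) y - of_bool (Vertex v = y)"
proof (cases y)
  case (Vertex w)
  then show ?thesis by (auto simp: tent_fwd_def tent_bwd_def interp_def)
next
  case (Inner e0 s)
  have "(\<Sum>e\<in>edges G. of_bool (src G e = v) * tent_fwd G e y 0 - of_bool (tgt G e = v) * tent_bwd G e y (len G e))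
     = (\<Sum>e\<in>edges G. if e = e0 then of_bool (src G e = v) * (1 - s / len G e) + of_bool (tgt G e = v) * (s / len G e) else 0)"
    by (rule sum.cong) (use assms in \<open>auto simp: tent_fwd_def tent_bwd_def Inner\<close>)
  also have "\<dots> = interp G (delta v) y"
    using assms by (auto simp: Inner interp_def field_simps)
  finally show ?thesis by (simp add: Inner)
qed

lemma outflow_vertex_edgewise:
  assumes "edgewise_potential G y z f" "y \<in> points G" "z \<in> points G"
  shows "outflow G f (Vertex v) = energy G (\<lambda>v. f (Vertex v)) (delta v) -
    (interp G (delta v) y - of_bool (Vertex v = y)) + (interp G (delta v) z - of_bool (Vertex v = z))"
proof -
  let ?D = "\<lambda>e. (f (Vertex (tgt G e)) - f (Vertex (src G e))) / len G e"
  let ?S = "\<lambda>y e. of_bool (src G e = v) * tent_fwd G e y 0 - of_bool (tgt G e = v) * tent_bwd G e y (len G e)"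
  have "outflow G f (Vertex v) = (\<Sum>e\<in>edges G. of_bool (src G e = v) * current_fwd G f e 0) +
      (\<Sum>e\<in>edges G. of_bool (tgt G e = v) * current_bwd G f e (len G e))"
    \<comment> \<open>Indicators replace the filtered index sets, so that both sums run over all
      edges and a loop at \<open>v\<close> is counted twice without a case distinction.\<close>
    by (simp add: sum.inter_filter of_bool_def if_distrib[of "\<lambda>x. x * _"] cong: if_cong)
  also have "\<dots> = (\<Sum>e\<in>edges G. of_bool (src G e = v) * current_fwd G f e 0 +
      of_bool (tgt G e = v) * current_bwd G f e (len G e))"
    by (simp add: sum.distrib)
  also have "\<dots> = (\<Sum>e\<in>edges G. (f (Vertex (tgt G e)) - f (Vertex (src G e))) *
        (delta v (tgt G e) - delta v (src G e)) / len G e - ?S y e + ?S z e)"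
  proof (rule sum.cong)
    fix e assume "e \<in> edges G"
    then show "of_bool (src G e = v) * current_fwd G f e 0 + of_bool (tgt G e = v) * current_bwd G f e (len G e) =
      (f (Vertex (tgt G e)) - f (Vertex (src G e))) *
        (delta v (tgt G e) - delta v (src G e)) / len G e - ?S y e + ?S z e"
      using current_fwd_edgewise[OF assms, of e 0] current_bwd_edgewise[OF assms, of e "len G e"] len_pos[of e]
      by (simp add: field_simps)
  qed simp
  also have "\<dots> = energy G (\<lambda>v. f (Vertex v)) (delta v) - sum (?S y) (edges G) + sum (?S z) (edges G)"
    by (simp add: energy_def sum.distrib sum_subtractf)
  finally show ?thesis
    using tent_slopes_at_vertex[OF assms(2), of v] tent_slopes_at_vertex[OF assms(3), of v] by simp
qed

text \<open>Subtracting the tents cancels exactly the slope jumps prescribed at terminals inside the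
  edge. What remains is piecewise affine without kinks, hence affine on the whole edge, and its end
  values are those of \<open>f\<close> because tents vanish at the ends.\<close>

lemma unit_potential_imp_edgewise:
  assumes "unit_potential G y z f" "y \<in> points G" "z \<in> points G"
  shows "edgewise_potential G y z f"
  unfolding edgewise_potential_def
proof (intro ballI)
  fix e t assume e: "e \<in> edges G" and t: "t \<in> {0..len G e}"
  let ?L = "len G e"
  let ?F = "\<lambda>t. f (pt G e t) - tent G e y t + tent G e z t"
  \<comment> \<open>The possible break points on this edge: at most two parameters, those of the
    terminals.\<close>
  define S where "S = {s. Inner e s = y \<or> Inner e s = z}"
  let ?par = "\<lambda>x. case x of Vertex _ \<Rightarrow> 0 | Inner _ s \<Rightarrow> s"
  have "S \<subseteq> {?par y, ?par z}" unfolding S_def by auto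
  then have "finite S" by (rule finite_subset) simp
  have out: "outflow G f x = of_bool (x = y) - of_bool (x = z)" if "x \<in> points G" for x
    using assms(1) that unfolding unit_potential_def by blast
  have ohm: "\<exists>c. \<forall>t\<in>{a..b}. f (pt G e t) = f (pt G e a) + c * (t - a)"
    and avoid: "\<forall>t\<in>{a<..<b}. pt G e t \<noteq> y \<and> pt G e t \<noteq> z"
    if ab: "0 \<le> a" "a < b" "b \<le> ?L" "{a<..<b} \<inter> S = {}" for a b
  proof -
    show *: "\<forall>t\<in>{a<..<b}. pt G e t \<noteq> y \<and> pt G e t \<noteq> z"
    proof
      fix t assume t: "t \<in> {a<..<b}"
      then have "pt G e t = Inner e t" using ab(1,3) by (intro pt_simps) auto
      moreover have "t \<notin> S" using t ab(4) by blast
      ultimately show "pt G e t \<noteq> y \<and> pt G e t \<noteq> z" by (auto simp: S_def)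
    qed
    then obtain c where "\<And>t. t \<in> {a..b} \<Longrightarrow> f (pt G e a) - f (pt G e t) = c * (t - a)"
      using assms(1) e ab(1-3) unfolding unit_potential_def by blast
    then have "\<forall>t\<in>{a..b}. f (pt G e t) = f (pt G e a) + (- c) * (t - a)"
      by fastforce
    then show "\<exists>c. \<forall>t\<in>{a..b}. f (pt G e t) = f (pt G e a) + c * (t - a)" by blast
  qed
  have "\<exists>c. \<forall>t\<in>{0..?L}. ?F t = ?F 0 + c * (t - 0)"
  proof (rule affine_if_piecewise_affine_no_kink[where S = S])
    fix a b :: real assume ab: "0 \<le> a" "a < b" "b \<le> ?L" "{a<..<b} \<inter> S = {}"
    obtain c where c: "\<And>t. t \<in> {a..b} \<Longrightarrow> f (pt G e t) = f (pt G e a) + c * (t - a)"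
      using ohm[OF ab] by blast
    obtain c1 where c1: "\<And>t. t \<in> {a..b} \<Longrightarrow> tent G e y t = tent G e y a + c1 * (t - a)"
      using tent_affine_segment[OF e assms(2) ab(1-3)] avoid[OF ab] by blast
    obtain c2 where c2: "\<And>t. t \<in> {a..b} \<Longrightarrow> tent G e z t = tent G e z a + c2 * (t - a)"
      using tent_affine_segment[OF e assms(3) ab(1-3)] avoid[OF ab] by blast
    have "\<forall>t\<in>{a..b}. ?F t = ?F a + (c - c1 + c2) * (t - a)"
    proof
      fix t assume "t \<in> {a..b}"
      from c[OF this] c1[OF this] c2[OF this]
      show "?F t = ?F a + (c - c1 + c2) * (t - a)" unfolding ring_distribs by linarith
    qed
    then show "\<exists>c. \<forall>t\<in>{a..b}. ?F t = ?F a + c * (t - a)" by blast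
  next
    fix s assume "s \<in> S" and s: "0 < s" "s < ?L"
    obtain d where d: "d > 0" "\<And>x. x \<in> S \<Longrightarrow> x \<noteq> s \<Longrightarrow> d \<le> dist s x"
      using finite_set_avoid[OF \<open>finite S\<close>, of s] by blast
    obtain b1 where b1: "s < b1" "b1 \<le> ?L"
      "\<And>r. r \<in> {s..b1} \<Longrightarrow> tent G e y r = tent G e y s + tent_fwd G e y s * (r - s)"
      using tent_affine_right[OF e assms(2) less_imp_le[OF s(1)] s(2)] by blast
    obtain b2 where b2: "s < b2" "b2 \<le> ?L"
      "\<And>r. r \<in> {s..b2} \<Longrightarrow> tent G e z r = tent G e z s + tent_fwd G e z s * (r - s)"
      using tent_affine_right[OF e assms(3) less_imp_le[OF s(1)] s(2)] by blast
    obtain a1 where a1: "a1 < s" "0 \<le> a1"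
      "\<And>r. r \<in> {a1..s} \<Longrightarrow> tent G e y r = tent G e y s + tent_bwd G e y s * (r - s)"
      using tent_affine_left[OF e assms(2) s(1) less_imp_le[OF s(2)]] by blast
    obtain a2 where a2: "a2 < s" "0 \<le> a2"
      "\<And>r. r \<in> {a2..s} \<Longrightarrow> tent G e z r = tent G e z s + tent_bwd G e z s * (r - s)"
      using tent_affine_left[OF e assms(3) s(1) less_imp_le[OF s(2)]] by blast
    \<comment> \<open>The neighbourhood \<open>{a..b}\<close> of \<open>s\<close> is chosen so small
      that it has no other terminal in its interior and both tents are affine on either side of
      \<open>s\<close>.\<close>
    define b where "b = Min {s + d, b1, b2}"
    define a where "a = Max {s - d, a1, a2}"
    have b: "s < b" "b \<le> s + d" "b \<le> b1" "b \<le> b2" "b \<le> ?L"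
      using d(1) b1(1,2) b2(1,2) by (auto simp: b_def)
    have a: "a < s" "s - d \<le> a" "a1 \<le> a" "a2 \<le> a" "0 \<le> a"
      using d(1) a1(1,2) a2(1,2) by (auto simp: a_def)
    have "{s<..<b} \<inter> S = {}" "{a<..<s} \<inter> S = {}"
      using d(2) a(2) b(2) by (force simp: dist_real_def)+
    then obtain c1 c2 where c: "\<And>t. t \<in> {a..s} \<Longrightarrow> f (pt G e t) = f (pt G e a) + c1 * (t - a)"
      "\<And>t. t \<in> {s..b} \<Longrightarrow> f (pt G e t) = f (pt G e s) + c2 * (t - s)"
      using ohm[OF a(5) a(1) less_imp_le[OF s(2)]] ohm[OF less_imp_le[OF s(1)] b(1,5)] by meson
    have c1: "f (pt G e t) = f (pt G e s) + c1 * (t - s)" if "t \<in> {a..s}" for t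
      using c(1)[OF that] c(1)[of s] a(1) unfolding ring_distribs by simp
    have "current_fwd G f e s = - c2"
      unfolding current_fwd_def
      using vector_derivative_right_affine[where F = "\<lambda>s. f (pt G e s)", OF b(1,5) c(2)] by simp
    moreover have "current_bwd G f e s = c1"
      unfolding current_bwd_def
      using vector_derivative_left_affine[where F = "\<lambda>s. f (pt G e s)", OF a(1,5) c1] by simp
    moreover have "outflow G f (Inner e s) = of_bool (Inner e s = y) - of_bool (Inner e s = z)"
      using out[of "Inner e s"] s e by simp
    \<comment> \<open>Kirchhoff's law at the interior point \<open>s\<close>: the slope of
      \<open>f\<close> jumps there as the difference of the tents does.\<close>
    ultimately have jump: "c1 - c2 = of_bool (Inner e s = y) - of_bool (Inner e s = z)"
      by simp
    have "vector_derivative ?F (at s within {s..?L}) = c2 - tent_fwd G e y s + tent_fwd G e z s"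
    proof (rule vector_derivative_right_affine[where b = b])
      fix r assume r: "r \<in> {s..b}"
      then show "?F r = ?F s + (c2 - tent_fwd G e y s + tent_fwd G e z s) * (r - s)"
        using c(2)[OF r] b1(3)[of r] b2(3)[of r] b(3,4) unfolding ring_distribs by simp
    qed (use b in auto)
    moreover have "vector_derivative ?F (at s within {0..s}) = c1 - tent_bwd G e y s + tent_bwd G e z s"
    proof (rule vector_derivative_left_affine[where a = a])
      fix r assume r: "r \<in> {a..s}"
      then show "?F r = ?F s + (c1 - tent_bwd G e y s + tent_bwd G e z s) * (r - s)"
        using c1[OF r] a1(3)[of r] a2(3)[of r] a(3,4) unfolding ring_distribs by simp
    qed (use a in auto)
    ultimately show "vector_derivative ?F (at s within {s..?L}) = vector_derivative ?F (at s within {0..s})"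
      using jump tent_slope_jump[OF assms(2), of e s] tent_slope_jump[OF assms(3), of e s] by linarith
  qed (use \<open>finite S\<close> len_pos[OF e] in auto)
  then obtain c where c0: "\<forall>t\<in>{0..?L}. ?F t = ?F 0 + c * (t - 0)" by blast
  have c: "f (pt G e t) - tent G e y t + tent G e z t = f (Vertex (src G e)) + c * t"
    if "t \<in> {0..?L}" for t
    using bspec[OF c0 that] unfolding tent_ends[OF assms(2) e] tent_ends[OF assms(3) e] pt_simps(1)
    by simp
  have "f (Vertex (tgt G e)) = f (Vertex (src G e)) + c * ?L"
    using c[of ?L] less_imp_le[OF len_pos[OF e]]
    by (simp add: tent_ends[OF assms(2) e] tent_ends[OF assms(3) e] pt_simps(2)[OF e])
  then have "(f (Vertex (tgt G e)) - f (Vertex (src G e))) * t / ?L = c * t"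
    using e by simp
  then show "f (pt G e t) =
     interp G (\<lambda>v. f (Vertex v)) (pt G e t) + tent G e y t - tent G e z t"
    using c[OF t] unfolding interp_pt[OF e t] by linarith
qed

text \<open>All conditions off the vertices are absorbed in the edgewise form. At a vertex the
  \<open>of_bool\<close> terms of the outflow match the prescribed current, which leaves a finite
  linear system for the vertex values.\<close>

theorem unit_potential_iff:
  assumes y: "y \<in> points G" and z: "z \<in> points G"
  shows "unit_potential G y z f \<longleftrightarrow> edgewise_potential G y z f \<and>
    (\<forall>v\<in>vertices G. energy G (\<lambda>v. f (Vertex v)) (delta v) = interp G (delta v) y - interp G (delta v) z)"
    (is "_ \<longleftrightarrow> _ \<and> ?K")
proof (intro iffI conjI)
  assume u: "unit_potential G y z f"
  show ew: "edgewise_potential G y z f"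
    by (rule unit_potential_imp_edgewise) fact+
  show ?K
  proof
    fix v assume "v \<in> vertices G"
    then have "Vertex v \<in> points G" by simp
    then have "outflow G f (Vertex v) = of_bool (Vertex v = y) - of_bool (Vertex v = z)"
      using u unfolding unit_potential_def by blast
    then show "energy G (\<lambda>v. f (Vertex v)) (delta v) = interp G (delta v) y - interp G (delta v) z"
      using outflow_vertex_edgewise[OF ew y z, of v] by simp
  qed
next
  assume "edgewise_potential G y z f \<and> ?K"
  then have ew: "edgewise_potential G y z f" and K: ?K by auto
  show "unit_potential G y z f"
    unfolding unit_potential_def
  proof (intro conjI ballI allI impI)
    fix e a b assume e: "e \<in> edges G" and ab: "0 \<le> a \<and> a < b \<and> b \<le> len G e \<and>
      (\<forall>t\<in>{a<..<b}. pt G e t \<noteq> y \<and> pt G e t \<noteq> z)"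
    obtain c1 where c1: "\<And>t. t \<in> {a..b} \<Longrightarrow> tent G e y t = tent G e y a + c1 * (t - a)"
      using tent_affine_segment[OF e y, of a b] ab by blast
    obtain c2 where c2: "\<And>t. t \<in> {a..b} \<Longrightarrow> tent G e z t = tent G e z a + c2 * (t - a)"
      using tent_affine_segment[OF e z, of a b] ab by blast
    let ?c = "- (f (Vertex (tgt G e)) - f (Vertex (src G e))) / len G e - c1 + c2"
    have f: "f (pt G e r) = f (Vertex (src G e)) +
        (f (Vertex (tgt G e)) - f (Vertex (src G e))) * r / len G e + tent G e y r - tent G e z r"
      if "r \<in> {0..len G e}" for r
      using ew e that by (auto simp: edgewise_potential_def interp_pt)
    have "f (pt G e a) - f (pt G e t) = ?c * (t - a)" if t: "t \<in> {a..b}" for t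
    proof -
      have at: "a \<in> {0..len G e}" "t \<in> {0..len G e}" using t ab by auto
      show ?thesis
        unfolding f[OF at(1)] f[OF at(2)] c1[OF t] c2[OF t]
        by (simp add: ring_distribs diff_divide_distrib)
    qed
    then show "\<exists>c. \<forall>t\<in>{a..b}. f (pt G e a) - f (pt G e t) = c * (t - a)" by blast
  next
    fix x assume x: "x \<in> points G"
    show "outflow G f x = of_bool (x = y) - of_bool (x = z)"
    proof (cases x)
      case (Vertex v)
      then show ?thesis
        using x K outflow_vertex_edgewise[OF ew y z, of v] by (simp del: outflow.simps)
    next
      case (Inner e t)
      then show ?thesis
        using x current_fwd_edgewise[OF ew y z, of e t] current_bwd_edgewise[OF ew y z, of e t]
          tent_slope_jump[OF y, of e t] tent_slope_jump[OF z, of e t] by simp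
    qed
  qed
qed

text \<open>Linearity in the pole: as seen from the vertices, a source inside an edge is the convex
  combination of sources at its ends.\<close>

lemma energy_interp_green:
  assumes g: "green_kernel G z0 g" and y: "y \<in> points G"
  shows "energy G (\<lambda>a. interp G (g a) y) \<phi> = interp G \<phi> y - \<phi> z0"
proof (cases y)
  case (Vertex v)
  then show ?thesis using y green_kernelD(3)[OF g] by (simp add: interp_def)
next
  case (Inner e t)
  have "energy G (\<lambda>a. interp G (g a) y) \<phi> =
      energy G (\<lambda>a. g a (src G e) + (t / len G e) * (g a (tgt G e) - g a (src G e))) \<phi>"
    by (rule arg_cong[where f = "\<lambda>h. energy G h \<phi>"]) (auto simp: Inner interp_def)
  also have "\<dots> = interp G \<phi> y - \<phi> z0"
    unfolding energy_add_left energy_scale_left energy_diff_left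
    using y by (simp add: green_kernelD(3)[OF g] Inner interp_def)
  finally show ?thesis .
qed

lemma point_kernel_Vertex: "point_kernel G g (Vertex v) y = interp G (g v) y"
  by (simp add: point_kernel_def interp_def)

lemma unit_potential_point_kernel:
  assumes g: "green_kernel G z0 g" and y: "y \<in> points G" and z: "z \<in> points G"
  shows "unit_potential G y z (\<lambda>x. point_kernel G g x y - point_kernel G g x z)"
  unfolding unit_potential_iff[OF y z]
proof (intro conjI ballI)
  show "edgewise_potential G y z (\<lambda>x. point_kernel G g x y - point_kernel G g x z)"
    unfolding edgewise_potential_def
    using y z by (auto simp: point_kernel_pt interp_pt point_kernel_Vertex field_simps)
  fix v assume "v \<in> vertices G"
  then show "energy G (\<lambda>v. point_kernel G g (Vertex v) y - point_kernel G g (Vertex v) z) (delta v) =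
      interp G (delta v) y - interp G (delta v) z"
    by (simp add: point_kernel_Vertex energy_diff_left energy_interp_green[OF g y] energy_interp_green[OF g z])
qed

text \<open>The tents cancel in the difference, which is therefore interpolated from its vertex
  values; there it has zero energy and so is constant.\<close>

lemma unit_potential_unique:
  assumes "unit_potential G y z f" "unit_potential G y z f'" and y: "y \<in> points G" and z: "z \<in> points G"
  obtains c where "\<And>x. x \<in> points G \<Longrightarrow> f x = f' x + c"
proof -
  note f = assms(1)[unfolded unit_potential_iff[OF y z]]
  note f' = assms(2)[unfolded unit_potential_iff[OF y z]]
  let ?h = "\<lambda>v. f (Vertex v) - f' (Vertex v)"
  have "energy G ?h (delta v) = 0" if "v \<in> vertices G" for v
    unfolding energy_diff_left using conjunct2[OF f] conjunct2[OF f'] that by simp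
  then have "energy G ?h ?h = 0"
    using energy_expand[of "vertices G" ?h ?h] by simp
  then have const: "?h u = ?h v" if "u \<in> vertices G" "v \<in> vertices G" for u v
    using energy_eq_0_constant[of ?h] that by blast
  obtain v0 where v0: "v0 \<in> vertices G" using vertices_nonempty by blast
  have "f x = f' x + ?h v0" if x: "x \<in> points G" for x
  proof (cases x)
    case (Vertex v)
    then show ?thesis using const[of v v0] x v0 by simp
  next
    case (Inner e t)
    then have e: "e \<in> edges G" and t: "t \<in> {0..len G e}" and xt: "x = pt G e t"
      using x pt_simps(3)[of t e] by auto
    have h: "?h (src G e) = ?h v0" "?h (tgt G e) = ?h v0"
      by (rule const[OF src_in[OF e] v0], rule const[OF tgt_in[OF e] v0])
    have "f x - f' x = interp G (\<lambda>v. f (Vertex v)) x - interp G (\<lambda>v. f' (Vertex v)) x"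
      using conjunct1[OF f, unfolded edgewise_potential_def, rule_format, OF e t]
        conjunct1[OF f', unfolded edgewise_potential_def, rule_format, OF e t] unfolding xt by linarith
    also have "\<dots> = ?h (src G e) + (?h (tgt G e) - ?h (src G e)) * t / len G e"
      unfolding xt interp_pt[OF e t] by (simp add: ring_distribs diff_divide_distrib)
    finally show ?thesis using h by simp
  qed
  then show ?thesis by (rule that)
qed

lemma unit_potential_diff_const:
  assumes "unit_potential G y z f" "y \<in> points G" "z \<in> points G"
  shows "unit_potential G y z (\<lambda>x. f x - c)"
proof -
  have "interp G (\<lambda>v. h v - c) x = interp G h x - c" for h x
    by (auto simp: interp_def split: gpoint.splits)
  then show ?thesis
    using assms(1) unfolding unit_potential_iff[OF assms(2,3)] edgewise_potential_def
      energy_diff_left energy_const_left by auto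
qed

text \<open>The explicit potential, shifted to vanish at \<open>z\<close>, is a witness, and
  potentials agree up to a constant that the value at \<open>z\<close> fixes. The double difference
  makes the result independent of where \<open>g\<close> is grounded.\<close>

theorem jfun_point_kernel:
  assumes g: "green_kernel G z0 g" and "x \<in> points G" "y \<in> points G" "z \<in> points G"
  shows "jfun G z x y = point_kernel G g x y - point_kernel G g x z
    - (point_kernel G g z y - point_kernel G g z z)"
    (is "_ = ?f x - ?f z")
  unfolding jfun_def
proof (rule the_equality)
  have "unit_potential G y z (\<lambda>x. ?f x - ?f z)"
    by (rule unit_potential_diff_const[OF unit_potential_point_kernel[OF g assms(3,4)] assms(3,4)])
  then show "\<exists>f. unit_potential G y z f \<and> f z = 0 \<and> f x = ?f x - ?f z"
    by (intro exI[of _ "\<lambda>x. ?f x - ?f z"] conjI) simp_all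
next
  fix c assume "\<exists>f. unit_potential G y z f \<and> f z = 0 \<and> f x = c"
  then obtain f where f: "unit_potential G y z f" "f z = 0" "f x = c" by blast
  obtain d where "\<And>x. x \<in> points G \<Longrightarrow> f x = ?f x + d"
    using unit_potential_unique[OF f(1) unit_potential_point_kernel[OF g assms(3,4)] assms(3,4)] by blast
  from this[OF assms(2)] this[OF assms(4)] f(2,3) show "c = ?f x - ?f z" by linarith
qed

theorem eff_res_point_kernel:
  assumes g: "green_kernel G z0 g" and "x \<in> points G" "y \<in> points G"
  shows "eff_res G x y = point_kernel G g x x - point_kernel G g x y
    - (point_kernel G g y x - point_kernel G g y y)"
    (is "_ = ?f x - ?f y")
  unfolding eff_res_def
proof (rule the_equality)
  show "\<exists>f. unit_potential G x y f \<and> f x - f y = ?f x - ?f y"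
    using unit_potential_point_kernel[OF assms] by blast
next
  fix c assume "\<exists>f. unit_potential G x y f \<and> f x - f y = c"
  then obtain f where f: "unit_potential G x y f" "f x - f y = c" by blast
  obtain d where "\<And>x. x \<in> points G \<Longrightarrow> f x = ?f x + d"
    using unit_potential_unique[OF f(1) unit_potential_point_kernel[OF assms] assms(2,3)] by blast
  from this[OF assms(2)] this[OF assms(3)] f(2) show "c = ?f x - ?f y" by linarith
qed

end

section \<open>Vertex formulas for the tau constant and for A\<close>

lemma has_integral_affine_squared:
  fixes a b u v :: real
  assumes "u \<le> v"
  shows "((\<lambda>t. (a + b * t)\<^sup>2) has_integral
    (a\<^sup>2 * (v - u) + a * b * (v\<^sup>2 - u\<^sup>2) + b\<^sup>2 * (v ^ 3 - u ^ 3) / 3)) {u..v}"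
proof -
  let ?H = "\<lambda>t. a\<^sup>2 * t + a * b * t\<^sup>2 + b\<^sup>2 * t ^ 3 / 3"
  have "((\<lambda>t. (a + b * t)\<^sup>2) has_integral (?H v - ?H u)) {u..v}"
  proof (rule fundamental_theorem_of_calculus[OF assms])
    fix t assume "t \<in> {u..v}"
    have "(?H has_real_derivative (a + b * t)\<^sup>2) (at t within {u..v})"
      by (auto intro!: derivative_eq_intros simp: power2_eq_square algebra_simps)
    then show "(?H has_vector_derivative (a + b * t)\<^sup>2) (at t within {u..v})"
      by (simp add: has_real_derivative_iff_has_vector_derivative)
  qed
  then show ?thesis by (simp add: algebra_simps diff_divide_distrib)
qed

lemma has_integral_deriv_squared:
  fixes H :: "real \<Rightarrow> real"
  assumes "u \<le> v" "\<And>t. t \<in> {u<..<v} \<Longrightarrow> H t = c + a * t + b * t\<^sup>2"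
  shows "((\<lambda>t. (deriv H t)\<^sup>2) has_integral
    (a\<^sup>2 * (v - u) + a * (2 * b) * (v\<^sup>2 - u\<^sup>2) + (2 * b)\<^sup>2 * (v ^ 3 - u ^ 3) / 3)) {u..v}"
proof (rule has_integral_spike_finite[OF _ _ has_integral_affine_squared[OF assms(1)]])
  show "finite {u, v}" by simp
  fix t assume "t \<in> {u..v} - {u, v}"
  then have t: "t \<in> {u<..<v}" by auto
  have "((\<lambda>t. c + a * t + b * t\<^sup>2) has_real_derivative a + 2 * b * t) (at t)"
    by (auto intro!: derivative_eq_intros)
  then have "(H has_real_derivative a + 2 * b * t) (at t)"
    by (rule has_field_derivative_transform_within_open[of _ _ _ "{u<..<v}"]) (use t assms(2) in auto)
  then show "(deriv H t)\<^sup>2 = (a + 2 * b * t)\<^sup>2"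
    by (simp add: DERIV_imp_deriv)
qed

text \<open>The slope is \<open>B / L + F * (1 - 2 * t / L)\<close>. The second summand has mean 0,
  so the cross term vanishes, and the square of \<open>1 - 2 * t / L\<close> integrates to
  \<open>L / 3\<close>.\<close>

lemma integral_deriv_squared_concave:
  fixes H :: "real \<Rightarrow> real"
  assumes L: "0 < L" and H: "\<And>t. t \<in> {0..L} \<Longrightarrow> H t = A + B * t / L + F * (t * (L - t) / L)"
  shows "integral {0..L} (\<lambda>t. (deriv H t)\<^sup>2) = B\<^sup>2 / L + F\<^sup>2 * L / 3"
proof -
  have "((\<lambda>t. (deriv H t)\<^sup>2) has_integral ((B / L + F)\<^sup>2 * (L - 0) +
      (B / L + F) * (2 * (- F / L)) * (L\<^sup>2 - 0\<^sup>2) + (2 * (- F / L))\<^sup>2 * (L ^ 3 - 0 ^ 3) / 3)) {0..L}"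
  proof (rule has_integral_deriv_squared)
    fix t assume "t \<in> {0<..<L}"
    then show "H t = A + (B / L + F) * t + (- F / L) * t\<^sup>2"
      using L H[of t] by (simp add: field_simps power2_eq_square)
  qed (use L in auto)
  then have "integral {0..L} (\<lambda>t. (deriv H t)\<^sup>2) = (B / L + F)\<^sup>2 * (L - 0) +
      (B / L + F) * (2 * (- F / L)) * (L\<^sup>2 - 0\<^sup>2) + (2 * (- F / L))\<^sup>2 * (L ^ 3 - 0 ^ 3) / 3"
    by (rule integral_unique)
  also have "\<dots> = B\<^sup>2 / L + F\<^sup>2 * L / 3"
    using L by (simp add: field_simps power2_eq_square power3_eq_cube)
  finally show ?thesis .
qed

text \<open>Integrating a slope against that of the tent evaluates, at \<open>s\<close>, a function
  vanishing at both ends. The tent and \<open>t * (L - t) / L\<close> both have the value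
  \<open>s - s\<^sup>2 / L\<close> there, which yields the square term with factor 4 and the cross
  term with factor \<open>- 4 * F\<close>; the linear part has no cross term with either.\<close>

lemma integral_deriv_squared_concave_tent:
  fixes H :: "real \<Rightarrow> real"
  assumes s: "0 < s" "s < L" and H: "\<And>t. t \<in> {0..L} \<Longrightarrow>
    H t = A + B * t / L + F * (t * (L - t) / L) - 2 * (min t s - t * s / L)"
  shows "integral {0..L} (\<lambda>t. (deriv H t)\<^sup>2) =
    B\<^sup>2 / L + F\<^sup>2 * L / 3 + 4 * (s - s\<^sup>2 / L) * (1 - F)"
proof -
  have L: "0 < L" using s by simp
  let ?a = "B / L + F - 2 * (1 - s / L)" and ?a' = "B / L + F + 2 * (s / L)" and ?b = "- F / L"
  let ?I = "?a\<^sup>2 * (s - 0) + ?a * (2 * ?b) * (s\<^sup>2 - 0\<^sup>2) + (2 * ?b)\<^sup>2 * (s ^ 3 - 0 ^ 3) / 3"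
  let ?I' = "?a'\<^sup>2 * (L - s) + ?a' * (2 * ?b) * (L\<^sup>2 - s\<^sup>2) + (2 * ?b)\<^sup>2 * (L ^ 3 - s ^ 3) / 3"
  have "((\<lambda>t. (deriv H t)\<^sup>2) has_integral ?I) {0..s}"
  proof (rule has_integral_deriv_squared)
    fix t assume "t \<in> {0<..<s}"
    then show "H t = A + ?a * t + ?b * t\<^sup>2"
      using s H[of t] by (simp add: field_simps power2_eq_square)
  qed (use s in auto)
  moreover have "((\<lambda>t. (deriv H t)\<^sup>2) has_integral ?I') {s..L}"
  proof (rule has_integral_deriv_squared)
    fix t assume "t \<in> {s<..<L}"
    then show "H t = (A - 2 * s) + ?a' * t + ?b * t\<^sup>2"
      using s H[of t] by (simp add: field_simps power2_eq_square)
  qed (use s in auto)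
  ultimately have "((\<lambda>t. (deriv H t)\<^sup>2) has_integral ?I + ?I') {0..L}"
    by (rule has_integral_combine[rotated 2]) (use s in auto)
  then have "integral {0..L} (\<lambda>t. (deriv H t)\<^sup>2) = ?I + ?I'" by (rule integral_unique)
  also have "\<dots> = B\<^sup>2 / L + F\<^sup>2 * L / 3 + 4 * (s - s\<^sup>2 / L) * (1 - F)"
  proof -
    \<comment> \<open>In these dimensionless variables the claim becomes a polynomial identity, with
      \<open>L\<close> as a common factor.\<close>
    define b \<sigma> where "b = B / L" and "\<sigma> = s / L"
    have Bs: "B = L * b" "s = L * \<sigma>" using L by (simp_all add: b_def \<sigma>_def)
    have a: "?a = b + F - 2 * (1 - \<sigma>)" "?a' = b + F + 2 * \<sigma>"
      by (simp_all add: b_def \<sigma>_def)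
    have "a\<^sup>2 * (s - 0) + a * (2 * ?b) * (s\<^sup>2 - 0\<^sup>2) + (2 * ?b)\<^sup>2 * (s ^ 3 - 0 ^ 3) / 3 =
        L * (a\<^sup>2 * \<sigma> - 2 * a * F * \<sigma>\<^sup>2 + 4 * F\<^sup>2 * \<sigma> ^ 3 / 3)" for a
      unfolding Bs(2) using L by (simp add: field_simps power2_eq_square power3_eq_cube)
    moreover have "a\<^sup>2 * (L - s) + a * (2 * ?b) * (L\<^sup>2 - s\<^sup>2) + (2 * ?b)\<^sup>2 * (L ^ 3 - s ^ 3) / 3 =
        L * (a\<^sup>2 * (1 - \<sigma>) - 2 * a * F * (1 - \<sigma>\<^sup>2) + 4 * F\<^sup>2 * (1 - \<sigma> ^ 3) / 3)" for a
      unfolding Bs(2) using L by (simp add: field_simps power2_eq_square power3_eq_cube)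
    moreover have "B\<^sup>2 / L + F\<^sup>2 * L / 3 + 4 * (s - s\<^sup>2 / L) * (1 - F) =
        L * (b\<^sup>2 + F\<^sup>2 / 3 + 4 * (\<sigma> - \<sigma>\<^sup>2) * (1 - F))"
      unfolding Bs using L by (simp add: power2_eq_square algebra_simps)
    ultimately show ?thesis
      unfolding a by (simp only:)
        (simp add: power2_eq_square power3_eq_cube algebra_simps diff_divide_distrib)
  qed
  finally show ?thesis .
qed

text \<open>The slope of \<open>H\<close> is constant, so only the mean of \<open>f\<close> matters;
  the \<open>6\<close> comes from the mean \<open>L / 6\<close> of
  \<open>t * (L - t) / L\<close>.\<close>

lemma integral_concave_times_slope:
  fixes f H :: "real \<Rightarrow> real"
  assumes L: "0 < L" and f: "\<And>t. t \<in> {0..L} \<Longrightarrow> f t = a + (b - a) * t / L + F * (t * (L - t) / L)"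
    and H: "\<And>t. t \<in> {0..L} \<Longrightarrow> H t = c + D * t / L"
  shows "integral {0..L} (\<lambda>t. f t * (deriv H t)\<^sup>2) = D\<^sup>2 / L * ((a + b) / 2 + F * L / 6)"
proof -
  let ?K = "\<lambda>t. (D / L)\<^sup>2 * (a * t + (b - a) / L * t\<^sup>2 / 2 + F * (t\<^sup>2 / 2 - t ^ 3 / (3 * L)))"
  let ?k = "\<lambda>t. (D / L)\<^sup>2 * (a + (b - a) / L * t + F * (t - t\<^sup>2 / L))"
  have "(?k has_integral (?K L - ?K 0)) {0..L}"
  proof (rule fundamental_theorem_of_calculus)
    fix t assume "t \<in> {0..L}"
    have "(?K has_real_derivative ?k t) (at t within {0..L})"
      using L less_imp_neq[OF L] by (auto intro!: derivative_eq_intros simp: field_simps)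
    then show "(?K has_vector_derivative ?k t) (at t within {0..L})"
      by (simp add: has_real_derivative_iff_has_vector_derivative)
  qed (use L in simp)
  then have "((\<lambda>t. f t * (deriv H t)\<^sup>2) has_integral (?K L - ?K 0)) {0..L}"
  proof (rule has_integral_spike_finite[rotated 2])
    show "finite {0, L}" by simp
    fix t assume "t \<in> {0..L} - {0, L}"
    then have t: "t \<in> {0<..<L}" by auto
    have "((\<lambda>t. c + D * t / L) has_real_derivative D / L) (at t)"
      using L by (auto intro!: derivative_eq_intros)
    then have "(H has_real_derivative D / L) (at t)"
      by (rule has_field_derivative_transform_within_open[of _ _ _ "{0<..<L}"]) (use t H in auto)
    then have "deriv H t = D / L" by (rule DERIV_imp_deriv)
    moreover have "f t = a + (b - a) / L * t + F * (t - t\<^sup>2 / L)"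
      using f[of t] t L by (simp add: field_simps power2_eq_square)
    ultimately show "f t * (deriv H t)\<^sup>2 = ?k t" by simp
  qed
  then have "integral {0..L} (\<lambda>t. f t * (deriv H t)\<^sup>2) = ?K L - ?K 0"
    by (rule integral_unique)
  also have "\<dots> = D\<^sup>2 / L * ((a + b) / 2 + F * L / 6)"
    using L by (simp add: field_simps power2_eq_square power3_eq_cube)
  finally show ?thesis .
qed

text \<open>The \<open>F\<close> of the overview, known as the Foster coefficient. It is invariant
  under scaling.\<close>

definition edge_slack :: "('v, 'e) mgraph \<Rightarrow> 'e \<Rightarrow> real" where
  "edge_slack G e = 1 - eff_res G (Vertex (src G e)) (Vertex (tgt G e)) / len G e"

context metrized
begin

lemma eff_res_vertices:
  assumes g: "green_kernel G z0 g" and "x \<in> vertices G" "y \<in> vertices G"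
  shows "eff_res G (Vertex x) (Vertex y) = g x x + g y y - 2 * g x y"
  using eff_res_point_kernel[OF g, of "Vertex x" "Vertex y"] assms green_kernel_sym[OF g assms(2,3)]
  by (simp add: point_kernel_Vertex interp_def)

lemma point_kernel_sym:
  assumes g: "green_kernel G z0 g" and "x \<in> points G" "y \<in> points G"
  shows "point_kernel G g x y = point_kernel G g y x"
proof (cases x; cases y)
  fix e t e' s assume xy: "x = Inner e t" "y = Inner e' s"
  note sym = green_kernel_sym[OF g]
  have "g (src G e') (src G e) = g (src G e) (src G e')" "g (src G e') (tgt G e) = g (tgt G e) (src G e')"
    "g (tgt G e') (src G e) = g (src G e) (tgt G e')" "g (tgt G e') (tgt G e) = g (tgt G e) (tgt G e')"
    by (rule sym; use assms xy in simp)+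
  then show ?thesis
    by (simp add: xy point_kernel_def interp_def tent_def min.commute algebra_simps
        add_divide_distrib diff_divide_distrib)
qed (use assms green_kernel_sym[OF g] in \<open>auto simp: point_kernel_def interp_def tent_def\<close>)

text \<open>On the diagonal, bilinear interpolation falls short of linear interpolation by
  \<open>r * t * (L - t) / L\<^sup>2\<close>, where \<open>r\<close> is the resistance between the
  ends, while the tent adds \<open>t * (L - t) / L\<close>. The sum of the two corrections has the
  slack as its coefficient.\<close>

lemma point_kernel_diag:
  assumes g: "green_kernel G z0 g" and e: "e \<in> edges G" and t: "t \<in> {0..len G e}"
  shows "point_kernel G g (pt G e t) (pt G e t) =
    interp G (\<lambda>v. g v v) (pt G e t) + edge_slack G e * (t * (len G e - t) / len G e)"
    and "interp G (\<lambda>v. interp G (g v) (pt G e t)) (pt G e t) =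
      point_kernel G g (pt G e t) (pt G e t) - (t - t\<^sup>2 / len G e)"
proof -
  let ?u = "src G e" and ?w = "tgt G e" and ?L = "len G e"
  have tent: "tent G e (pt G e t) t = t - t\<^sup>2 / ?L"
    using t e len_pos[OF e] by (auto simp: pt_def tent_def power2_eq_square)
  have k: "point_kernel G g (pt G e t) (pt G e t) =
      interp G (\<lambda>v. interp G (g v) (pt G e t)) (pt G e t) + (t - t\<^sup>2 / ?L)"
    using point_kernel_pt[OF e t, of "pt G e t" g] e tent by simp
  then show "interp G (\<lambda>v. interp G (g v) (pt G e t)) (pt G e t) =
      point_kernel G g (pt G e t) (pt G e t) - (t - t\<^sup>2 / len G e)" by simp
  have "g ?w ?u = g ?u ?w" by (rule green_kernel_sym[OF g]) (use e in auto)
  then show "point_kernel G g (pt G e t) (pt G e t) =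
    interp G (\<lambda>v. g v v) (pt G e t) + edge_slack G e * (t * (len G e - t) / len G e)"
    unfolding k interp_pt[OF e t] edge_slack_def
    using e by (simp add: eff_res_vertices[OF g]) (simp add: field_simps power2_eq_square)
qed

lemma eff_res_pt:
  assumes e: "e \<in> edges G" and t: "t \<in> {0..len G e}" and y: "y \<in> points G"
  shows "eff_res G (pt G e t) y = interp G (\<lambda>v. eff_res G (Vertex v) y) (pt G e t) +
    edge_slack G e * (t * (len G e - t) / len G e) - 2 * tent G e y t"
proof -
  obtain z0 g where g: "green_kernel G z0 g"
    using vertices_nonempty green_kernel_exists by blast
  have r: "eff_res G x y = point_kernel G g x x + point_kernel G g y y - 2 * point_kernel G g x y"
    if "x \<in> points G" for x
    using eff_res_point_kernel[OF g that y] point_kernel_sym[OF g that y] by simp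
  have rv: "eff_res G (Vertex v) y = g v v + point_kernel G g y y - 2 * interp G (g v) y"
    if "v \<in> vertices G" for v
    using r[of "Vertex v"] that by (simp add: point_kernel_Vertex interp_def)
  have x: "pt G e t \<in> points G" using e by simp
  show ?thesis
    unfolding r[OF x] point_kernel_diag(1)[OF g e t] point_kernel_pt[OF e t y] interp_pt[OF e t]
      rv[OF src_in[OF e]] rv[OF tgt_in[OF e]]
    using e by (simp add: field_simps)
qed

lemma integral_edge_deriv_eff_res:
  assumes e: "e \<in> edges G" and y: "y \<in> points G"
  shows "integral {0..len G e} (\<lambda>t. (edge_deriv G (\<lambda>x. eff_res G x y) e t)\<^sup>2) =
    (eff_res G (Vertex (tgt G e)) y - eff_res G (Vertex (src G e)) y)\<^sup>2 / len G e +
    (edge_slack G e)\<^sup>2 * len G e / 3 +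
    (case y of Vertex _ \<Rightarrow> 0
      | Inner e' s \<Rightarrow> if e' = e then 4 * (s - s\<^sup>2 / len G e) * (1 - edge_slack G e) else 0)"
proof (cases "\<exists>s. y = Inner e s")
  case True
  then obtain s where s: "y = Inner e s" by blast
  show ?thesis
    unfolding edge_deriv_def
    by (subst integral_deriv_squared_concave_tent[where s = s])
      (use y s eff_res_pt[OF e _ y] in \<open>auto simp: interp_pt[OF e] tent_def\<close>)
next
  case False
  then have "tent G e y t = 0" for t
    by (auto simp: tent_def split: gpoint.splits)
  then show ?thesis
    unfolding edge_deriv_def using False
    by (subst integral_deriv_squared_concave)
      (use eff_res_pt[OF e _ y] len_pos[OF e] in \<open>auto simp: interp_pt[OF e] split: gpoint.splits\<close>)
qed

text \<open>Up to a constant, the resistance to \<open>y\<close> is the diagonal of \<open>g\<close>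
  minus twice the kernel with pole \<open>y\<close>, and reproducing evaluates the extra terms at
  \<open>y\<close>. At a vertex they cancel; inside an edge the interpolated diagonal and the
  interpolated kernel differ from \<open>point_kernel G g y y\<close> by different multiples of
  \<open>s - s\<^sup>2 / L\<close>.\<close>

lemma energy_eff_res:
  assumes g: "green_kernel G z0 g" and y: "y \<in> points G"
  shows "energy G (\<lambda>v. eff_res G (Vertex v) y) (\<lambda>v. eff_res G (Vertex v) y) =
    energy G (\<lambda>v. g v v) (\<lambda>v. g v v) -
    (case y of Vertex _ \<Rightarrow> 0
      | Inner e s \<Rightarrow> 4 * (s - s\<^sup>2 / len G e) * (1 - edge_slack G e))"
proof -
  let ?d = "\<lambda>v. g v v" and ?k = "\<lambda>v. interp G (g v) y"
  have "eff_res G (Vertex v) y = g v v + point_kernel G g y y - 2 * interp G (g v) y"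
    if "v \<in> vertices G" for v
    using eff_res_point_kernel[OF g _ y, of "Vertex v"] point_kernel_sym[OF g _ y, of "Vertex v"] that
    by (simp add: point_kernel_Vertex interp_def)
  then have "energy G (\<lambda>v. eff_res G (Vertex v) y) (\<lambda>v. eff_res G (Vertex v) y) =
      energy G (\<lambda>v. ?d v + point_kernel G g y y - 2 * ?k v) (\<lambda>v. ?d v + point_kernel G g y y - 2 * ?k v)"
    by (intro energy_cong) auto
  also have "\<dots> = energy G ?d ?d - 4 * energy G ?k ?d + 4 * energy G ?k ?k"
    unfolding energy_linear by (simp add: energy_commute[of G ?d ?k])
  also have "\<dots> = energy G ?d ?d - 4 * (interp G ?d y - g z0 z0) + 4 * (interp G ?k y - interp G (g z0) y)"
    unfolding energy_interp_green[OF g y] by simp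
  also have "g z0 z0 = 0" using green_kernelD(1,2)[OF g] by simp
  also have "interp G (g z0) y = 0"
    using y green_kernelD(2)[OF g] by (cases y) (auto simp: interp_def)
  also have "energy G ?d ?d - 4 * (interp G ?d y - 0) + 4 * (interp G ?k y - 0) = energy G ?d ?d -
    (case y of Vertex _ \<Rightarrow> 0
      | Inner e s \<Rightarrow> 4 * (s - s\<^sup>2 / len G e) * (1 - edge_slack G e))"
  proof (cases y)
    case (Vertex v)
    then show ?thesis by (simp add: interp_def)
  next
    case (Inner e s)
    then have e: "e \<in> edges G" and s: "s \<in> {0..len G e}" and ys: "y = pt G e s"
      using y pt_simps(3)[of s e] by auto
    define k where "k = s - s\<^sup>2 / len G e"
    have "s * (len G e - s) / len G e = k"
      using e by (simp add: k_def field_simps power2_eq_square)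
    then have "interp G ?d y = point_kernel G g y y - edge_slack G e * k"
      "interp G ?k y = point_kernel G g y y - k"
      using point_kernel_diag[OF g e s] unfolding ys k_def[symmetric] by simp_all
    then show ?thesis unfolding Inner gpoint.case k_def[symmetric] by (simp add: algebra_simps)
  qed
  finally show ?thesis .
qed

text \<open>For a pole inside an edge, the loss in the energy of the vertex resistances equals the
  extra term in the integral over that edge. The integral is thus the same for all poles, and the
  description defining \<open>tau\<close> has a unique solution.\<close>

theorem tau_green:
  assumes g: "green_kernel G z0 g"
  shows "4 * tau G = energy G (\<lambda>v. g v v) (\<lambda>v. g v v) + (\<Sum>e\<in>edges G. (edge_slack G e)\<^sup>2 * len G e) / 3"
proof -
  let ?T = "energy G (\<lambda>v. g v v) (\<lambda>v. g v v) + (\<Sum>e\<in>edges G. (edge_slack G e)\<^sup>2 * len G e) / 3"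
  have int: "graph_integral G (\<lambda>e t. (edge_deriv G (\<lambda>x. eff_res G x y) e t)\<^sup>2) = ?T"
    if y: "y \<in> points G" for y
  proof -
    let ?X = "\<lambda>e. case y of Vertex _ \<Rightarrow> 0
      | Inner e' s \<Rightarrow> if e' = e then 4 * (s - s\<^sup>2 / len G e) * (1 - edge_slack G e) else 0"
    have "graph_integral G (\<lambda>e t. (edge_deriv G (\<lambda>x. eff_res G x y) e t)\<^sup>2) =
       (\<Sum>e\<in>edges G. (eff_res G (Vertex (tgt G e)) y - eff_res G (Vertex (src G e)) y)\<^sup>2 / len G e +
          (edge_slack G e)\<^sup>2 * len G e / 3 + ?X e)"
      unfolding graph_integral_def by (rule sum.cong) (auto simp: integral_edge_deriv_eff_res[OF _ y])
    also have "\<dots> = energy G (\<lambda>v. eff_res G (Vertex v) y) (\<lambda>v. eff_res G (Vertex v) y) +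
       (\<Sum>e\<in>edges G. (edge_slack G e)\<^sup>2 * len G e) / 3 + sum ?X (edges G)"
      by (simp add: sum.distrib energy_def power2_eq_square sum_divide_distrib)
    also have "sum ?X (edges G) = (case y of Vertex _ \<Rightarrow> 0
      | Inner e s \<Rightarrow> 4 * (s - s\<^sup>2 / len G e) * (1 - edge_slack G e))"
      using y by (cases y) auto
    finally show ?thesis unfolding energy_eff_res[OF g y] by simp
  qed
  have "tau G = 1/4 * ?T"
    unfolding tau_def
  proof (rule the_equality)
    show "\<forall>y\<in>points G. 1/4 * ?T =
      1/4 * graph_integral G (\<lambda>e t. (edge_deriv G (\<lambda>x. eff_res G x y) e t)\<^sup>2)"
      using int by simp
    fix c assume c: "\<forall>y\<in>points G. c = 1/4 * graph_integral G (\<lambda>e t. (edge_deriv G (\<lambda>x. eff_res G x y) e t)\<^sup>2)"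
    have z0: "Vertex z0 \<in> points G" using green_kernelD(1)[OF g] by simp
    show "c = 1/4 * ?T" using bspec[OF c z0] unfolding int[OF z0] .
  qed
  then show ?thesis by simp
qed

text \<open>With \<open>p\<close> grounded, the first factor is the diagonal kernel value at
  \<open>x\<close> minus the interpolated column \<open>g _ q\<close>, and the function whose slope
  is squared is that column itself. On each edge this is a concave function times a constant squared
  slope.\<close>

theorem A_const_green:
  assumes g: "green_kernel G p g" and q: "q \<in> vertices G"
  shows "A_const G (Vertex p) (Vertex q) = (\<Sum>e\<in>edges G.
    (g (tgt G e) q - g (src G e) q)\<^sup>2 / len G e *
    ((g (src G e) (src G e) - g (src G e) q + (g (tgt G e) (tgt G e) - g (tgt G e) q)) / 2 +
      edge_slack G e * len G e / 6))"
  unfolding A_const_def graph_integral_def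
proof (rule sum.cong)
  fix e assume e: "e \<in> edges G"
  let ?h = "\<lambda>v. g v v - g v q"
  have p: "p \<in> vertices G" using green_kernelD(1)[OF g] .
  have gp: "g p v = 0" "g v p = 0" if "v \<in> vertices G" for v
    using green_kernelD(2)[OF g that] green_kernel_sym[OF g that p] by simp_all
  have kq: "point_kernel G g (pt G e t) (Vertex v) = interp G (\<lambda>a. g a v) (pt G e t)"
    if "t \<in> {0..len G e}" "v \<in> vertices G" for t v
    using point_kernel_pt[OF e that(1), of "Vertex v" g] that(2) by (simp add: interp_def tent_def)
  have kp: "point_kernel G g (Vertex p) x = 0" if "x \<in> points G" for x
    using that gp by (cases x) (auto simp: point_kernel_Vertex interp_def)
  show "integral {0..len G e} (\<lambda>t. jfun G (pt G e t) (Vertex p) (Vertex q) *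
      (edge_deriv G (\<lambda>x. jfun G (Vertex p) x (Vertex q)) e t)\<^sup>2) =
    (g (tgt G e) q - g (src G e) q)\<^sup>2 / len G e *
    ((?h (src G e) + ?h (tgt G e)) / 2 + edge_slack G e * len G e / 6)"
    unfolding edge_deriv_def
  proof (rule integral_concave_times_slope[OF len_pos[OF e]])
    fix t assume t: "t \<in> {0..len G e}"
    have "jfun G (pt G e t) (Vertex p) (Vertex q) =
        point_kernel G g (pt G e t) (pt G e t) - interp G (\<lambda>a. g a q) (pt G e t)"
      using jfun_point_kernel[OF g, of "Vertex p" "Vertex q" "pt G e t"] e p q kq[OF t q] by (simp add: kp)
    then show "jfun G (pt G e t) (Vertex p) (Vertex q) = ?h (src G e) +
        (?h (tgt G e) - ?h (src G e)) * t / len G e + edge_slack G e * (t * (len G e - t) / len G e)"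
      unfolding point_kernel_diag(1)[OF g e t] interp_pt[OF e t] by (simp add: ring_distribs diff_divide_distrib)
    have "jfun G (Vertex p) (pt G e t) (Vertex q) = interp G (\<lambda>a. g a q) (pt G e t) - interp G (\<lambda>a. g a p) (pt G e t)"
      using jfun_point_kernel[OF g, of "pt G e t" "Vertex q" "Vertex p"] e p q kq[OF t q] kq[OF t p] by (simp add: kp)
    then show "jfun G (Vertex p) (pt G e t) (Vertex q) =
        g (src G e) q + (g (tgt G e) q - g (src G e) q) * t / len G e"
      unfolding interp_pt[OF e t] using gp e by simp
  qed
qed simp

end

section \<open>Scaling and edge deletion\<close>

text \<open>The factor stands on the right, as in the length function of
  \<open>edge_replacement\<close>.\<close>

definition rescale :: "real \<Rightarrow> ('v, 'e) mgraph \<Rightarrow> ('v, 'e) mgraph" where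
  "rescale c G = G\<lparr>len := \<lambda>e. len G e * c\<rparr>"

lemma skel_rescale [simp]: "skel (rescale c G) = skel G"
  and len_rescale [simp]: "len (rescale c G) e = len G e * c"
  by (simp_all add: rescale_def)

lemma normalization_eq_rescale: "normalization G = rescale (1 / total_length G) G"
  by (simp add: normalization_def rescale_def)

lemma energy_rescale: "energy (rescale c G) f g = energy G f g / c"
  by (simp add: energy_def sum_divide_distrib)

lemma green_kernel_rescale:
  assumes "green_kernel G z g" "0 < c"
  shows "green_kernel (rescale c G) z (\<lambda>x y. c * g x y)"
  using assms unfolding green_kernel_def energy_rescale energy_scale_left by simp

context metrized
begin

lemma metrized_graph_rescale: "0 < c \<Longrightarrow> metrized_graph (rescale c G)"
  using metrized by (simp add: metrized_graph_def)

lemma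
  assumes c: "0 < c"
  shows eff_res_rescale: "\<And>x y. x \<in> vertices G \<Longrightarrow> y \<in> vertices G \<Longrightarrow>
      eff_res (rescale c G) (Vertex x) (Vertex y) = c * eff_res G (Vertex x) (Vertex y)"
    and edge_slack_rescale: "\<And>e. e \<in> edges G \<Longrightarrow> edge_slack (rescale c G) e = edge_slack G e"
    and tau_rescale: "tau (rescale c G) = c * tau G"
proof -
  obtain z0 g where g: "green_kernel G z0 g"
    using vertices_nonempty green_kernel_exists by blast
  note g' = green_kernel_rescale[OF g c]
  interpret S: metrized "rescale c G"
    by unfold_locales (rule metrized_graph_rescale[OF c])
  show r: "eff_res (rescale c G) (Vertex x) (Vertex y) = c * eff_res G (Vertex x) (Vertex y)"
    if "x \<in> vertices G" "y \<in> vertices G" for x y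
    unfolding eff_res_vertices[OF g that]
    by (subst S.eff_res_vertices[OF g']) (use that in \<open>auto simp: algebra_simps\<close>)
  show s: "edge_slack (rescale c G) e = edge_slack G e" if "e \<in> edges G" for e
    using that c by (simp add: edge_slack_def r)
  have "4 * tau (rescale c G) = energy G (\<lambda>v. c * g v v) (\<lambda>v. c * g v v) / c +
      (\<Sum>e\<in>edges G. (edge_slack G e)\<^sup>2 * (len G e * c)) / 3"
    using S.tau_green[OF g'] by (simp add: energy_rescale s)
  also have "\<dots> = c * (4 * tau G)"
    unfolding tau_green[OF g] energy_scale_left energy_scale_right
    using c by (simp add: sum_distrib_left algebra_simps)
  finally show "tau (rescale c G) = c * tau G" by simp
qed

text \<open>Slopes are unchanged under scaling, while the potential and the arclength contribute a
  factor \<open>c\<close> each.\<close>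

lemma A_const_rescale:
  assumes c: "0 < c" and p: "p \<in> vertices G" and q: "q \<in> vertices G"
  shows "A_const (rescale c G) (Vertex p) (Vertex q) = c\<^sup>2 * A_const G (Vertex p) (Vertex q)"
proof -
  obtain g where g: "green_kernel G p g" using p green_kernel_exists by blast
  interpret S: metrized "rescale c G"
    by unfold_locales (rule metrized_graph_rescale[OF c])
  have g': "green_kernel (rescale c G) p (\<lambda>x y. c * g x y)" by (rule green_kernel_rescale[OF g c])
  have q': "q \<in> vertices (rescale c G)" using q by simp
  show ?thesis
    unfolding S.A_const_green[OF g' q'] A_const_green[OF g q] sum_distrib_left
  proof (rule sum.cong)
    fix e assume e: "e \<in> edges G"
    define L a b a' b' F where "L = len G e"
      "a = g (src G e) (src G e)" "b = g (src G e) q" "a' = g (tgt G e) (tgt G e)" "b' = g (tgt G e) q"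
      "F = edge_slack G e"
    note defs = this
    have "(c * b' - c * b)\<^sup>2 / (L * c) * ((c * a - c * b + (c * a' - c * b')) / 2 + F * (L * c) / 6) =
      c\<^sup>2 * ((b' - b)\<^sup>2 / L * ((a - b + (a' - b')) / 2 + F * L / 6))"
    proof -
      have "c * b' - c * b = c * (b' - b)"
        "(c * a - c * b + (c * a' - c * b')) / 2 + F * (L * c) / 6 = c * ((a - b + (a' - b')) / 2 + F * L / 6)"
        by (simp_all add: algebra_simps)
      then show ?thesis using c by (simp add: power2_eq_square)
    qed
    then show "(c * g (tgt (rescale c G) e) q - c * g (src (rescale c G) e) q)\<^sup>2 / len (rescale c G) e *
      ((c * g (src (rescale c G) e) (src (rescale c G) e) - c * g (src (rescale c G) e) q +
        (c * g (tgt (rescale c G) e) (tgt (rescale c G) e) - c * g (tgt (rescale c G) e) q)) / 2 +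
        edge_slack (rescale c G) e * len (rescale c G) e / 6) =
      c\<^sup>2 * ((g (tgt G e) q - g (src G e) q)\<^sup>2 / len G e *
      ((g (src G e) (src G e) - g (src G e) q + (g (tgt G e) (tgt G e) - g (tgt G e) q)) / 2 +
        edge_slack G e * len G e / 6))"
      by (simp add: edge_slack_rescale[OF c e] defs)
  qed simp
qed

lemma eff_res_pos:
  assumes "x \<in> vertices G" "y \<in> vertices G" "x \<noteq> y"
  shows "0 < eff_res G (Vertex x) (Vertex y)"
proof -
  obtain g where g: "green_kernel G x g" using assms green_kernel_exists by blast
  show ?thesis
    using eff_res_vertices[OF g assms(1,2)] green_kernel_diag_pos[OF g assms(2)] assms
      green_kernelD(2)[OF g assms(1)] green_kernelD(2)[OF g assms(2)] by simp
qed

lemma eff_res_nonneg: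
  "x \<in> vertices G \<Longrightarrow> y \<in> vertices G \<Longrightarrow> 0 \<le> eff_res G (Vertex x) (Vertex y)"
proof (cases "x = y")
  case True
  assume "x \<in> vertices G"
  then obtain g where "green_kernel G x g" using green_kernel_exists by blast
  then show ?thesis using eff_res_vertices[of x g x x] True \<open>x \<in> _\<close> by simp
qed (use eff_res_pos less_imp_le in blast)

lemma eff_res_green:
  assumes g: "green_kernel G z g" and x: "x \<in> vertices G"
  shows "eff_res G (Vertex x) (Vertex z) = g x x"
  using eff_res_vertices[OF g x green_kernelD(1)[OF g]] green_kernelD(1,2)[OF g] x
    green_kernel_sym[OF g x green_kernelD(1)[OF g]] by simp

section \<open>Slack in terms of the resistance after deletion of the edge\<close>

lemma energy_delete_edge:
  assumes "e \<in> edges G"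
  shows "energy G f \<phi> = energy (delete_edge G e) f \<phi> +
    (f (tgt G e) - f (src G e)) * (\<phi> (tgt G e) - \<phi> (src G e)) / len G e"
  unfolding energy_def delete_edge_def pre_digraph.del_arc_def
  by (simp add: sum.remove[OF finite_edges assms])

lemma delete_edge_simps:
  "vertices (delete_edge G e) = vertices G" "edges (delete_edge G e) = edges G - {e}"
  "src (delete_edge G e) = src G" "tgt (delete_edge G e) = tgt G" "len (delete_edge G e) = len G"
  by (simp_all add: delete_edge_def pre_digraph.del_arc_def)

text \<open>Reproducing with the kernel of \<open>G\<close> and splitting off the edge
  \<open>e\<close> gives \<open>key\<close>. For \<open>f\<close> the potential of the deleted graph
  it becomes the parallel law \<open>R = r + R * r / L\<close>. If deletion disconnects, a function
  constant along the remaining edges but not across \<open>e\<close> forces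
  \<open>r = L\<close>.\<close>

theorem inverse_len_plus_edge_res:
  assumes e: "e \<in> edges G"
  shows "real_of_ereal (1 / (ereal (len G e) + edge_res G e)) = edge_slack G e / len G e"
proof -
  let ?u = "src G e" and ?w = "tgt G e" and ?L = "len G e" and ?D = "delete_edge G e"
  have u: "?u \<in> vertices G" and w: "?w \<in> vertices G" using e by auto
  obtain g where g: "green_kernel G ?w g" using w green_kernel_exists by blast
  let ?r = "eff_res G (Vertex ?u) (Vertex ?w)"
  have r: "?r = g ?u ?u" by (rule eff_res_green[OF g u])
  have key: "f ?u - f ?w = energy ?D f (\<lambda>x. g x ?u) + (f ?u - f ?w) * ?r / ?L" for f
    using green_kernelD(4)[OF g u, of f] green_kernelD(2)[OF g u]
    unfolding energy_delete_edge[OF e] r by (simp add: algebra_simps)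
  have fin: "fin_digraph (skel ?D)"
    unfolding delete_edge_def using metrized fin_digraph.fin_digraph_del_arc[of "skel G" e]
    by (simp add: metrized_graph_def)
  then have wf: "wf_digraph (skel ?D)" by (simp add: fin_digraph_def)
  show ?thesis
  proof (cases "Digraph_Component.connected (skel ?D)")
    case True
    interpret D: metrized ?D
      using fin True len_pos by unfold_locales (simp add: metrized_graph_def delete_edge_simps)
    let ?R = "eff_res ?D (Vertex ?u) (Vertex ?w)"
    obtain g' where g': "green_kernel ?D ?w g'"
      using w D.green_kernel_exists[of ?w] by (auto simp: delete_edge_simps)
    have u': "?u \<in> vertices ?D" using u by (simp add: delete_edge_simps)
    have R: "?R = g' ?u ?u" by (rule D.eff_res_green[OF g' u'])
    \<comment> \<open>\<open>?R\<close> is 0 when \<open>e\<close> is a loop, so only the weak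
      inequality is available; \<open>?L + ?R\<close> is still positive.\<close>
    have "0 \<le> ?R" using D.eff_res_nonneg u w by (simp add: delete_edge_simps)
    have "g' ?w ?u = 0" using green_kernelD(2)[OF g' u'] .
    then have "?R = ?r + ?R * ?r / ?L"
      using key[of "\<lambda>x. g' x ?u"] green_kernelD(3)[OF g' u', of "\<lambda>x. g x ?u"]
        green_kernelD(2)[OF g u] R r by simp
    then have "?r = ?R * ?L / (?L + ?R)"
      using \<open>0 \<le> ?R\<close> len_pos[OF e] by (simp add: field_simps)
    then have "edge_slack G e / ?L = 1 / (?L + ?R)"
      using \<open>0 \<le> ?R\<close> len_pos[OF e] by (simp add: edge_slack_def field_simps)
    moreover have "real_of_ereal (1 / (ereal ?L + edge_res G e)) = 1 / (?L + ?R)"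
      using True \<open>0 \<le> ?R\<close> len_pos[OF e] by (simp add: edge_res_def one_ereal_def)
    ultimately show ?thesis by simp
  next
    case False
    then obtain f :: "'v \<Rightarrow> real" and x y where f: "\<And>e'. e' \<in> edges G - {e} \<Longrightarrow> f (src G e') = f (tgt G e')"
      and xy: "x \<in> vertices G" "y \<in> vertices G" "f x \<noteq> f y"
      using vertices_nonempty unfolding connected_iff_edge_invariant_constant[OF wf]
      by (auto simp: delete_edge_simps)
    have "f ?u \<noteq> f ?w"
    proof
      assume "f ?u = f ?w"
      then have "f (src G e') = f (tgt G e')" if "e' \<in> edges G" for e'
        using f[of e'] that by (cases "e' = e") auto
      then show False using edge_invariant_constant[of f x y] xy by blast
    qed
    moreover have "energy ?D f (\<lambda>x. g x ?u) = 0"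
      unfolding energy_def delete_edge_simps by (rule sum.neutral) (use f in simp)
    ultimately have "(f ?u - f ?w) * (?r / ?L) = (f ?u - f ?w) * 1" and "f ?u - f ?w \<noteq> 0"
      using key[of f] by simp_all
    then have "?r / ?L = 1" by (metis mult_cancel_left)
    then have "?r = ?L" using e by (simp add: field_simps)
    \<comment> \<open>The slack is 0 here, and so is the left-hand side, because
      \<open>edge_res\<close> is infinite.\<close>
    then show ?thesis
      using False e by (simp add: edge_slack_def edge_res_def)
  qed
qed

text \<open>The terms linear in \<open>F\<close> cancel because
  \<open>energy \<phi> (\<phi> h) = 0\<close>, the quadratic ones because \<open>energy \<phi> (P \<circ> \<phi>) = L\<^sup>3/3\<close> for
  \<open>P s = - (L - 2 s)\<^sup>3 / 6\<close>, the antiderivative of \<open>(L - 2 s)\<^sup>2\<close>.\<close>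

theorem inserted_graph_contribution:
  fixes a b F :: real
  assumes g: "green_kernel G p g" and q: "q \<in> vertices G" "q \<noteq> p" and L: "L = g q q"
    and d: "\<And>v. v \<in> vertices G \<Longrightarrow>
      d v = b + a * g v q + F * (g v q * (L - g v q) / L) + (g v v - g v q)"
  shows "energy G d d + (\<Sum>e\<in>edges G.
      (edge_slack G e + F * (g (tgt G e) q - g (src G e) q)\<^sup>2 / (L * len G e))\<^sup>2 * len G e) / 3 =
    a\<^sup>2 * L + F\<^sup>2 * L / 3 - L + 4 * tau G + 4 * F * A_const G (Vertex p) (Vertex q) / L"
proof -
  \<comment> \<open>\<open>\<phi>\<close> is the potential between the terminals,
    \<open>\<psi>\<close> the concave profile caused by the slack \<open>F\<close> of the replaced
    edge, and \<open>h v\<close> is the first factor of the integrand of \<open>A_const\<close> at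
    the vertex \<open>v\<close>. Both \<open>\<psi>\<close> and \<open>h\<close> vanish at
    \<open>p\<close> and \<open>q\<close>.\<close>
  define \<phi> where "\<phi> v = g v q" for v
  define h where "h v = g v v - \<phi> v" for v
  define \<psi> where "\<psi> v = \<phi> v * (L - \<phi> v) / L" for v
  define \<delta> where "\<delta> e = \<phi> (tgt G e) - \<phi> (src G e)" for e
  define S where "S = (\<Sum>e\<in>edges G. (\<delta> e)\<^sup>2 * (h (src G e) + h (tgt G e)) / len G e)"
  define S4 where "S4 = (\<Sum>e\<in>edges G. \<delta> e ^ 4 / len G e)"
  define T where "T = (\<Sum>e\<in>edges G. (edge_slack G e)\<^sup>2 * len G e)"
  define P where "P = (\<Sum>e\<in>edges G. edge_slack G e * (\<delta> e)\<^sup>2)"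
  have p: "p \<in> vertices G" using green_kernelD(1)[OF g] .
  have L0: "0 < L" using green_kernel_diag_pos[OF g q] L by simp
  have \<phi>pq: "\<phi> p = 0" "\<phi> q = L"
    using green_kernelD(2)[OF g q(1)] L by (simp_all add: \<phi>_def)
  have hpq: "h p = 0" "h q = 0"
    using green_kernelD(2)[OF g p] \<phi>pq L by (simp_all add: h_def)
  have \<psi>pq: "\<psi> p = 0" "\<psi> q = 0" by (simp_all add: \<psi>_def \<phi>pq)
  have E: "energy G \<phi> f = f q - f p" for f
    using green_kernelD(3)[OF g q(1), of f] by (simp add: \<phi>_def[abs_def])
  have E': "energy G f \<phi> = f q - f p" for f
    using E[of f] energy_commute[of G f \<phi>] by simp

  \<comment> \<open>The constant drops out, and \<open>\<phi>\<close> is orthogonal to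
    \<open>\<psi>\<close> and \<open>h\<close> because they vanish at both terminals.\<close>
  have "energy G d d = energy G (\<lambda>v. b + a * \<phi> v + F * \<psi> v + h v) (\<lambda>v. b + a * \<phi> v + F * \<psi> v + h v)"
    by (rule energy_cong) (auto simp: d \<psi>_def h_def \<phi>_def)
  also have "\<dots> = a\<^sup>2 * L + F\<^sup>2 * energy G \<psi> \<psi> + 2 * F * energy G \<psi> h + energy G h h"
    unfolding energy_linear E E' \<phi>pq hpq \<psi>pq energy_commute[of G h \<psi>]
    by (simp add: power2_eq_square algebra_simps)
  finally have dd: "energy G d d =
      a\<^sup>2 * L + F\<^sup>2 * energy G \<psi> \<psi> + 2 * F * energy G \<psi> h + energy G h h" .

  \<comment> \<open>On an edge the difference quotient of this cubic exceeds the midpoint value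
    \<open>(L - (x + y))\<^sup>2\<close> by \<open>(y - x)\<^sup>2 / 3\<close>. The excess
    accumulates to \<open>S4\<close>, which later cancels against the squared slack
    corrections.\<close>
  have "energy G \<phi> (\<lambda>v. - ((L - 2 * \<phi> v) ^ 3) / 6) =
      (\<Sum>e\<in>edges G. L\<^sup>2 * ((\<psi> (tgt G e) - \<psi> (src G e)) * (\<psi> (tgt G e) - \<psi> (src G e)) / len G e) +
         \<delta> e ^ 4 / len G e / 3)"
    unfolding energy_def
  proof (rule sum.cong)
    fix e assume "e \<in> edges G"
    define x y where "x = \<phi> (src G e)" "y = \<phi> (tgt G e)"
    have "L * (\<psi> (tgt G e) - \<psi> (src G e)) = (y - x) * (L - (x + y))"
      using L0 by (simp add: \<psi>_def x_y_def field_simps)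
    then have "L\<^sup>2 * ((\<psi> (tgt G e) - \<psi> (src G e)) * (\<psi> (tgt G e) - \<psi> (src G e))) =
        ((y - x) * (L - (x + y)))\<^sup>2"
      by (metis power2_eq_square power_mult_distrib)
    moreover have "(y - x) * (- ((L - 2 * y) ^ 3) / 6 - - ((L - 2 * x) ^ 3) / 6) =
        ((y - x) * (L - (x + y)))\<^sup>2 + (y - x) ^ 4 / 3"
      by (simp add: power2_eq_square power3_eq_cube power4_eq_xxxx field_simps)
    ultimately show "(\<phi> (tgt G e) - \<phi> (src G e)) *
        (- ((L - 2 * \<phi> (tgt G e)) ^ 3) / 6 - - ((L - 2 * \<phi> (src G e)) ^ 3) / 6) / len G e =
      L\<^sup>2 * ((\<psi> (tgt G e) - \<psi> (src G e)) * (\<psi> (tgt G e) - \<psi> (src G e)) / len G e) +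
         \<delta> e ^ 4 / len G e / 3"
      unfolding \<delta>_def x_y_def[symmetric] times_divide_eq_right
      by (simp add: add_divide_distrib)
  qed simp
  also have "\<dots> = L\<^sup>2 * energy G \<psi> \<psi> + S4 / 3"
    by (simp add: sum.distrib energy_def S4_def sum_distrib_left sum_divide_distrib)
  finally have \<psi>\<psi>: "L\<^sup>2 * energy G \<psi> \<psi> + S4 / 3 = L ^ 3 / 3"
    unfolding E \<phi>pq by simp

  \<comment> \<open>A discrete product rule rewrites the pairing through exact differences of
    \<open>h\<close> and \<open>\<phi> h\<close>; both vanish at the terminals, so only the
    remainder \<open>S\<close> survives.\<close>
  have "L * energy G \<psi> h = (\<Sum>e\<in>edges G.
      L * ((\<phi> (tgt G e) - \<phi> (src G e)) * (h (tgt G e) - h (src G e)) / len G e) -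
      2 * ((\<phi> (tgt G e) - \<phi> (src G e)) *
        (\<phi> (tgt G e) * h (tgt G e) - \<phi> (src G e) * h (src G e)) / len G e) +
      (\<delta> e)\<^sup>2 * (h (src G e) + h (tgt G e)) / len G e)"
    unfolding energy_def sum_distrib_left
  proof (rule sum.cong)
    fix e assume "e \<in> edges G"
    define x y k l where "x = \<phi> (src G e)" "y = \<phi> (tgt G e)" "k = h (src G e)" "l = h (tgt G e)"
    note defs = this
    have "L * (\<psi> (tgt G e) - \<psi> (src G e)) = (y - x) * (L - (x + y))"
      using L0 by (simp add: \<psi>_def defs field_simps)
    then have "L * ((\<psi> (tgt G e) - \<psi> (src G e)) * (l - k)) = (y - x) * (L - (x + y)) * (l - k)"
      by simp
    moreover have "(y - x) * (L - (x + y)) * (l - k) =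
        L * ((y - x) * (l - k)) - 2 * ((y - x) * (y * l - x * k)) + (y - x)\<^sup>2 * (k + l)"
      by (simp add: power2_eq_square algebra_simps)
    ultimately show "L * ((\<psi> (tgt G e) - \<psi> (src G e)) * (h (tgt G e) - h (src G e)) / len G e) =
      L * ((\<phi> (tgt G e) - \<phi> (src G e)) * (h (tgt G e) - h (src G e)) / len G e) -
      2 * ((\<phi> (tgt G e) - \<phi> (src G e)) *
        (\<phi> (tgt G e) * h (tgt G e) - \<phi> (src G e) * h (src G e)) / len G e) +
      (\<delta> e)\<^sup>2 * (h (src G e) + h (tgt G e)) / len G e"
      unfolding \<delta>_def defs[symmetric] times_divide_eq_right
      by (simp add: add_divide_distrib diff_divide_distrib)
  qed simp
  also have "\<dots> = L * energy G \<phi> h - 2 * energy G \<phi> (\<lambda>v. \<phi> v * h v) + S"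
    by (simp add: sum.distrib sum_subtractf energy_def S_def sum_distrib_left)
  finally have \<psi>h: "L * energy G \<psi> h = S"
    unfolding E \<phi>pq hpq by simp

  have "energy G (\<lambda>v. g v v) (\<lambda>v. g v v) = energy G (\<lambda>v. \<phi> v + h v) (\<lambda>v. \<phi> v + h v)"
    by (simp add: h_def)
  also have "\<dots> = L + energy G h h"
    unfolding energy_linear E E' \<phi>pq hpq by simp
  finally have \<tau>: "4 * tau G = L + energy G h h + T / 3"
    using tau_green[OF g] by (simp add: T_def)

  have "A_const G (Vertex p) (Vertex q) =
      (\<Sum>e\<in>edges G. (\<delta> e)\<^sup>2 * (h (src G e) + h (tgt G e)) / len G e / 2 + edge_slack G e * (\<delta> e)\<^sup>2 / 6)"
    unfolding A_const_green[OF g q(1)]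
    by (rule sum.cong) (auto simp: \<delta>_def h_def \<phi>_def distrib_left add_divide_distrib)
  also have "\<dots> = S / 2 + P / 6"
    by (simp add: sum.distrib S_def P_def sum_divide_distrib)
  finally have A: "A_const G (Vertex p) (Vertex q) = S / 2 + P / 6" .

  have "(\<Sum>e\<in>edges G. (edge_slack G e + F * (\<delta> e)\<^sup>2 / (L * len G e))\<^sup>2 * len G e) =
      (\<Sum>e\<in>edges G. (edge_slack G e)\<^sup>2 * len G e + 2 * F / L * (edge_slack G e * (\<delta> e)\<^sup>2) +
         F\<^sup>2 / L\<^sup>2 * (\<delta> e ^ 4 / len G e))"
  proof (rule sum.cong)
    fix e assume "e \<in> edges G"
    then show "(edge_slack G e + F * (\<delta> e)\<^sup>2 / (L * len G e))\<^sup>2 * len G e =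
        (edge_slack G e)\<^sup>2 * len G e + 2 * F / L * (edge_slack G e * (\<delta> e)\<^sup>2) +
         F\<^sup>2 / L\<^sup>2 * (\<delta> e ^ 4 / len G e)"
      using L0 len_pos[of e] by (simp add: field_simps power2_eq_square power4_eq_xxxx)
  qed simp
  also have "\<dots> = T + 2 * F / L * P + F\<^sup>2 / L\<^sup>2 * S4"
    by (simp add: sum.distrib T_def P_def S4_def sum_distrib_left)
  finally have slack: "(\<Sum>e\<in>edges G. (edge_slack G e + F * (g (tgt G e) q - g (src G e) q)\<^sup>2 / (L * len G e))\<^sup>2 * len G e)
      = T + 2 * F / L * P + F\<^sup>2 / L\<^sup>2 * S4"
    by (simp add: \<delta>_def \<phi>_def)

  have \<psi>\<psi>': "energy G \<psi> \<psi> = L / 3 - S4 / (3 * L\<^sup>2)"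
    using \<psi>\<psi> L0 by (simp add: field_simps power2_eq_square power3_eq_cube)
  have \<psi>h': "energy G \<psi> h = S / L"
    using \<psi>h L0 by (simp add: field_simps)
  \<comment> \<open>\<open>S\<close> from the energy and \<open>P\<close> from the slacks combine to
    \<open>4 * F / L\<close> times \<open>S / 2 + P / 6\<close>.\<close>
  show ?thesis
    unfolding slack dd \<tau> A \<psi>\<psi>' \<psi>h' by (simp add: algebra_simps add_divide_distrib)
qed

end

section \<open>Edge replacement\<close>

locale replacement =
  fixes \<Gamma> :: "('v, 'e) mgraph" and \<beta> :: "'e \<Rightarrow> ('w, 'f) mgraph" and p q :: "'e \<Rightarrow> 'w"
  assumes metrized_\<Gamma>: "metrized_graph \<Gamma>"
    and metrized_\<beta>: "\<And>i. i \<in> edges \<Gamma> \<Longrightarrow> metrized_graph (\<beta> i)"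
    and p_in: "\<And>i. i \<in> edges \<Gamma> \<Longrightarrow> p i \<in> vertices (\<beta> i)"
    and q_in: "\<And>i. i \<in> edges \<Gamma> \<Longrightarrow> q i \<in> vertices (\<beta> i)"
    and p_neq_q: "\<And>i. i \<in> edges \<Gamma> \<Longrightarrow> p i \<noteq> q i"
begin

sublocale \<Gamma>: metrized \<Gamma>
  by unfold_locales (rule metrized_\<Gamma>)

abbreviation H :: "('v + 'e \<times> 'w, 'e \<times> 'f) mgraph" where
  "H \<equiv> edge_replacement \<Gamma> \<beta> p q"

abbreviation gl :: "'e \<Rightarrow> 'w \<Rightarrow> 'v + 'e \<times> 'w" where
  "gl \<equiv> glue \<Gamma> p q"

definition ratio :: "'e \<Rightarrow> real" where
  "ratio i = len \<Gamma> i / eff_res (\<beta> i) (Vertex (p i)) (Vertex (q i))"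

definition B :: "'e \<Rightarrow> ('w, 'f) mgraph" where
  "B i = rescale (ratio i) (\<beta> i)"

lemma ratio_pos: "i \<in> edges \<Gamma> \<Longrightarrow> 0 < ratio i"
  using metrized.eff_res_pos[of "\<beta> i" "p i" "q i"] \<Gamma>.len_pos[of i] p_in q_in p_neq_q metrized_\<beta>
  by (simp add: ratio_def metrized_def)

lemma skel_B [simp]: "skel (B i) = skel (\<beta> i)"
  by (simp add: B_def)

lemma metrized_B: "i \<in> edges \<Gamma> \<Longrightarrow> metrized (B i)"
  unfolding B_def metrized_def
  using metrized.metrized_graph_rescale[of "\<beta> i"] metrized_\<beta> ratio_pos by (simp add: metrized_def)

lemma eff_res_B: "i \<in> edges \<Gamma> \<Longrightarrow> eff_res (B i) (Vertex (p i)) (Vertex (q i)) = len \<Gamma> i"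
  using metrized.eff_res_rescale[of "\<beta> i" "ratio i" "p i" "q i"] metrized.eff_res_pos[of "\<beta> i" "p i" "q i"]
    p_in q_in p_neq_q metrized_\<beta> ratio_pos
  by (simp add: B_def ratio_def metrized_def)

lemma edges_H: "edges H = (SIGMA i:edges \<Gamma>. edges (B i))"
  and vertices_H: "vertices H = Inl ` vertices \<Gamma> \<union> (\<Union>i\<in>edges \<Gamma>. gl i ` vertices (B i))"
  and src_H: "src H (i, e) = gl i (src (B i) e)"
  and tgt_H: "tgt H (i, e) = gl i (tgt (B i) e)"
  and len_H: "len H (i, e) = len (B i) e"
  by (simp_all add: edge_replacement_def B_def ratio_def)

lemma glue_p [simp]: "gl i (p i) = Inl (src \<Gamma> i)"
  by (simp add: glue_def)

text \<open>\<open>glue\<close> tests for \<open>p i\<close> first, so it is the distinctness of the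
  terminals that sends \<open>q i\<close> to the head.\<close>

lemma glue_q: "i \<in> edges \<Gamma> \<Longrightarrow> gl i (q i) = Inl (tgt \<Gamma> i)"
  using p_neq_q[of i] by (auto simp: glue_def)

lemma sum_edges_H: "(\<Sum>x\<in>edges H. f x) = (\<Sum>i\<in>edges \<Gamma>. \<Sum>e\<in>edges (B i). f (i, e))"
proof -
  have "\<forall>i\<in>edges \<Gamma>. finite (edges (B i))"
    using metrized_B metrized.finite_edges by blast
  then show ?thesis
    unfolding edges_H by (subst sum.Sigma) auto
qed

text \<open>Gluing identifies vertices only; the edge set is the disjoint union over the inserted
  graphs.\<close>

lemma energy_H: "energy H f h = (\<Sum>i\<in>edges \<Gamma>. energy (B i) (\<lambda>w. f (gl i w)) (\<lambda>w. h (gl i w)))"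
  unfolding energy_def sum_edges_H src_H tgt_H len_H ..

text \<open>For connectedness: an edge-invariant function is constant on each inserted copy, hence
  agrees at the two glued terminals. Its restriction to the vertices of \<Gamma> is then
  edge-invariant and so constant.\<close>

lemma metrized_graph_H: "metrized_graph H"
  unfolding metrized_graph_def
proof (intro conjI ballI)
  note fin = metrized.finite_edges[OF metrized_B] metrized.finite_vertices[OF metrized_B]
    metrized.src_in[OF metrized_B] metrized.tgt_in[OF metrized_B]
  have wf: "wf_digraph (skel H)"
  proof
    fix x assume "x \<in> edges H"
    then obtain i e where x: "x = (i, e)" "i \<in> edges \<Gamma>" "e \<in> edges (B i)"
      unfolding edges_H by blast
    show "src H x \<in> vertices H" "tgt H x \<in> vertices H"
      unfolding x(1) src_H tgt_H vertices_H
      by (rule UnI2, rule UN_I[OF x(2)], rule imageI, rule fin(3,4)[OF x(2,3)])+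
  qed
  have "finite (edges H)" "finite (vertices H)"
    unfolding edges_H vertices_H
    by (rule finite_SigmaI[OF \<Gamma>.finite_edges fin(1)], assumption)
      (intro finite_UnI finite_imageI finite_UN_I \<Gamma>.finite_vertices \<Gamma>.finite_edges fin(2))
  then show "fin_digraph (skel H)"
    using wf by (simp add: fin_digraph_def fin_digraph_axioms_def)
  show "0 < len H x" if xH: "x \<in> edges H" for x
  proof -
    obtain i e where x: "x = (i, e)" "i \<in> edges \<Gamma>" "e \<in> edges (B i)"
      using xH unfolding edges_H by blast
    show ?thesis unfolding x(1) len_H by (rule metrized.len_pos[OF metrized_B[OF x(2)] x(3)])
  qed
  show "Digraph_Component.connected (skel H)"
    unfolding connected_iff_edge_invariant_constant[OF wf]
  proof (intro conjI allI impI)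
    show "vertices H \<noteq> {}" unfolding vertices_H using \<Gamma>.vertices_nonempty by blast
    fix f :: "'v + 'e \<times> 'w \<Rightarrow> real"
    assume inv: "\<forall>x\<in>edges H. f (src H x) = f (tgt H x)"
    have loc: "f (gl i w) = f (gl i w')"
      if i: "i \<in> edges \<Gamma>" and "w \<in> vertices (B i)" "w' \<in> vertices (B i)" for i w w'
    proof (rule metrized.edge_invariant_constant[OF metrized_B[OF i], where f = "\<lambda>w. f (gl i w)"])
      fix e assume "e \<in> edges (B i)"
      then have "(i, e) \<in> edges H" using i unfolding edges_H by blast
      then show "f (gl i (src (B i) e)) = f (gl i (tgt (B i) e))"
        using inv unfolding src_H[symmetric] tgt_H[symmetric] by blast
    qed fact+
    obtain v0 where v0: "v0 \<in> vertices \<Gamma>" using \<Gamma>.vertices_nonempty by blast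
    have glob: "f (Inl v) = f (Inl v0)" if "v \<in> vertices \<Gamma>" for v
    proof (rule \<Gamma>.edge_invariant_constant[where f = "\<lambda>v. f (Inl v)"])
      fix i assume i: "i \<in> edges \<Gamma>"
      show "f (Inl (src \<Gamma> i)) = f (Inl (tgt \<Gamma> i))"
        using loc[OF i, of "p i" "q i"] p_in[OF i] q_in[OF i] glue_q[OF i] by simp
    qed fact+
    have "f x = f (Inl v0)" if xH: "x \<in> vertices H" for x
    proof -
      consider v where "x = Inl v" "v \<in> vertices \<Gamma>"
        | i w where "i \<in> edges \<Gamma>" "w \<in> vertices (B i)" "x = gl i w"
        using xH unfolding vertices_H by blast
      then show ?thesis
      proof cases
        case 1
        then show ?thesis using glob by simp
      next
        case 2
        have "f x = f (gl i (p i))" unfolding 2(3) by (rule loc[OF 2(1,2)]) (use p_in[OF 2(1)] in simp)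
        then show ?thesis using glob[OF \<Gamma>.src_in[OF 2(1)]] by simp
      qed
    qed
    then show "\<forall>x\<in>vertices H. \<forall>y\<in>vertices H. f x = f y" by simp
  qed
qed

sublocale H: metrized H
  by unfold_locales (rule metrized_graph_H)

end

text \<open>With the inserted graphs regarded as single resistors of resistance \<open>len \<Gamma> i\<close>, a potential of \<open>\<Gamma>\<close>
  extends to \<open>H\<close> by \<open>ext\<close>, and \<open>K i\<close> is the Green function of \<open>B i\<close> with \<open>p i\<close> and \<open>q i\<close> both grounded.\<close>

locale replacement_kernels = replacement +
  fixes z0 :: 'a and g :: "'a \<Rightarrow> 'a \<Rightarrow> real" and k :: "'b \<Rightarrow> 'c \<Rightarrow> 'c \<Rightarrow> real"
  assumes g: "green_kernel \<Gamma> z0 g"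
    and k: "\<And>i. i \<in> edges \<Gamma> \<Longrightarrow> green_kernel (B i) (p i) (k i)"
begin

text \<open>The potential for unit current from \<open>q i\<close> to the grounded
  \<open>p i\<close>. It runs from 0 to \<open>len \<Gamma> i\<close> and takes over the role of the
  arclength parameter on the edge \<open>i\<close>.\<close>

definition \<phi> :: "'b \<Rightarrow> 'c \<Rightarrow> real" where "\<phi> i w = k i w (q i)"

definition ext :: "('a \<Rightarrow> real) \<Rightarrow> 'a + 'b \<times> 'c \<Rightarrow> real" where
  "ext f x = (case x of Inl v \<Rightarrow> f v
     | Inr (i, w) \<Rightarrow> f (src \<Gamma> i) + (f (tgt \<Gamma> i) - f (src \<Gamma> i)) / len \<Gamma> i * \<phi> i w)"

definition K :: "'b \<Rightarrow> 'c \<Rightarrow> 'c \<Rightarrow> real" where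
  "K i w w' = k i w w' - \<phi> i w' / len \<Gamma> i * \<phi> i w"

definition loc :: "'a + 'b \<times> 'c \<Rightarrow> 'a + 'b \<times> 'c \<Rightarrow> real" where
  "loc x y = (case x of Inl _ \<Rightarrow> 0 | Inr (i, w) \<Rightarrow>
     (case y of Inl _ \<Rightarrow> 0 | Inr (j, w') \<Rightarrow> if i = j then K i w w' else 0))"

text \<open>The analogue of \<open>point_kernel\<close>: \<open>ext\<close> stands for interpolation
  along an edge, and \<open>loc\<close> for the tent.\<close>

definition gH :: "'a + 'b \<times> 'c \<Rightarrow> 'a + 'b \<times> 'c \<Rightarrow> real" where
  "gH x y = ext (\<lambda>a. ext (g a) y) x + loc x y"

lemma pq_in_B [simp]:
  "i \<in> edges \<Gamma> \<Longrightarrow> p i \<in> vertices (\<beta> i)" "i \<in> edges \<Gamma> \<Longrightarrow> q i \<in> vertices (\<beta> i)"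
  using p_in q_in by auto

lemma k_zero: "i \<in> edges \<Gamma> \<Longrightarrow> w \<in> vertices (\<beta> i) \<Longrightarrow> k i (p i) w = 0"
  using green_kernelD(2)[OF k, of i w] by simp

lemma k_sym: "i \<in> edges \<Gamma> \<Longrightarrow> w \<in> vertices (\<beta> i) \<Longrightarrow> w' \<in> vertices (\<beta> i) \<Longrightarrow> k i w w' = k i w' w"
  using green_kernel_sym[OF k, of i w w'] by simp

lemma \<phi>_ends:
  assumes i: "i \<in> edges \<Gamma>"
  shows "\<phi> i (p i) = 0" "\<phi> i (q i) = len \<Gamma> i"
proof -
  show "\<phi> i (p i) = 0" using k_zero[OF i] i by (simp add: \<phi>_def)
  show "\<phi> i (q i) = len \<Gamma> i"
    using metrized.eff_res_vertices[OF metrized_B[OF i] k[OF i], of "p i" "q i"] eff_res_B[OF i]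
      k_zero[OF i] i by (simp add: \<phi>_def)
qed

lemma K_ends:
  assumes "i \<in> edges \<Gamma>" "w \<in> vertices (\<beta> i)"
  shows "K i (p i) w = 0" "K i (q i) w = 0" "K i w (p i) = 0" "K i w (q i) = 0"
  using assms k_zero[of i] k_sym[of i w] \<phi>_ends[of i] unfolding K_def by (auto simp: \<phi>_def)

lemma ext_glue:
  assumes i: "i \<in> edges \<Gamma>"
  shows "ext f (gl i w) = f (src \<Gamma> i) + (f (tgt \<Gamma> i) - f (src \<Gamma> i)) / len \<Gamma> i * \<phi> i w"
  using \<phi>_ends[OF i] i by (auto simp: glue_def ext_def)

lemma loc_glue:
  assumes "i \<in> edges \<Gamma>" "w \<in> vertices (\<beta> i)" "w' \<in> vertices (\<beta> i)"
  shows "loc (gl i w) (gl i w') = K i w w'"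
  using assms K_ends[of i] by (auto simp: glue_def loc_def)

lemma energy_\<phi>: "i \<in> edges \<Gamma> \<Longrightarrow> energy (B i) (\<phi> i) f = f (q i) - f (p i)"
  using green_kernelD(3)[OF k, of i "q i" f] by (simp add: \<phi>_def[abs_def])

lemma energy_ext:
  assumes y: "y \<in> vertices H"
  shows "energy \<Gamma> (\<lambda>a. ext (g a) y) f = ext f y - f z0"
proof (cases y)
  case (Inl v)
  then have "v \<in> vertices \<Gamma>"
    using y unfolding vertices_H by (auto simp: glue_def split: if_splits)
  then show ?thesis using green_kernelD(3)[OF g] by (simp add: Inl ext_def)
next
  case (Inr jw)
  obtain j w where jw: "jw = (j, w)" by (cases jw)
  have j: "j \<in> edges \<Gamma>"
    using y unfolding vertices_H Inr jw by (auto simp: glue_def split: if_splits)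
  have "energy \<Gamma> (\<lambda>a. ext (g a) y) f =
      energy \<Gamma> (\<lambda>a. g a (src \<Gamma> j) + \<phi> j w / len \<Gamma> j * (g a (tgt \<Gamma> j) - g a (src \<Gamma> j))) f"
    unfolding Inr jw ext_def by (simp add: mult.commute)
  also have "\<dots> = ext f y - f z0"
    unfolding energy_add_left energy_scale_left energy_diff_left
    using j by (simp add: green_kernelD(3)[OF g] Inr jw ext_def)
  finally show ?thesis .
qed

text \<open>Pairing with the kernel grounded at both terminals returns the deviation of
  \<open>f\<close> from the extension of its values at the terminals. A copy without
  \<open>y\<close> in its interior contributes nothing.\<close>

lemma energy_loc:
  assumes i: "i \<in> edges \<Gamma>" and y: "y \<in> vertices H"
  shows "energy (B i) (\<lambda>w. loc (gl i w) y) (\<lambda>w. f (gl i w)) =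
    (case y of Inl _ \<Rightarrow> 0 | Inr (j, w) \<Rightarrow> if j = i then f y - ext (\<lambda>v. f (Inl v)) y else 0)"
proof (cases "\<exists>w. y = Inr (i, w)")
  case True
  then obtain w where w: "y = Inr (i, w)" by blast
  \<comment> \<open>A vertex of the form \<open>Inr\<close> never comes from a terminal, so
    \<open>gl i\<close> maps \<open>w\<close> back to \<open>y\<close>.\<close>
  have wB: "w \<in> vertices (\<beta> i)" and glw: "gl i w = y"
    using y unfolding vertices_H w by (auto simp: glue_def split: if_splits)
  interpret Bi: metrized "B i" by (rule metrized_B[OF i])
  have "energy (B i) (\<lambda>w'. loc (gl i w') y) (\<lambda>w. f (gl i w)) =
      energy (B i) (\<lambda>w'. k i w' w - \<phi> i w / len \<Gamma> i * \<phi> i w') (\<lambda>w. f (gl i w))"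
    unfolding glw[symmetric]
    by (rule Bi.energy_cong) (use loc_glue[OF i _ wB] in \<open>auto simp: K_def\<close>)
  also have "\<dots> = f y - f (gl i (p i)) - \<phi> i w / len \<Gamma> i * (f (gl i (q i)) - f (gl i (p i)))"
    unfolding energy_diff_left energy_scale_left energy_\<phi>[OF i]
    using green_kernelD(3)[OF k[OF i], of w "\<lambda>w. f (gl i w)"] wB glw by simp
  also have "\<dots> = f y - ext (\<lambda>v. f (Inl v)) y"
    unfolding glue_p glue_q[OF i] w by (simp add: ext_def)
  finally show ?thesis by (simp add: w)
next
  case False
  then have "loc x y = 0" if "x = gl i w" for x w
    unfolding that by (auto simp: loc_def glue_def split: sum.splits)
  then show ?thesis using False by (auto simp: energy_const_left split: sum.splits)
qed

text \<open>On each copy the extended part sees \<open>f\<close> only through its terminal values,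
  so these parts sum to an energy on \<Gamma> and give \<open>ext\<close> of \<open>f\<close> at
  \<open>y\<close> minus the value at \<open>z0\<close>. The local parts supply the missing
  deviation of \<open>f\<close> from that extension.\<close>

theorem green_kernel_H: "green_kernel H (Inl z0) gH"
  unfolding green_kernel_def
proof (intro conjI ballI allI)
  have z0: "z0 \<in> vertices \<Gamma>" using green_kernelD(1)[OF g] .
  then show "Inl z0 \<in> vertices H" unfolding vertices_H by blast
  fix y assume y: "y \<in> vertices H"
  show "gH (Inl z0) y = 0"
  proof (cases y)
    case (Inl v)
    then have "v \<in> vertices \<Gamma>"
      using y unfolding vertices_H by (auto simp: glue_def split: if_splits)
    then show ?thesis using green_kernelD(2)[OF g] by (simp add: gH_def ext_def loc_def Inl)
  next
    case (Inr jw)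
    obtain j w where jw: "jw = (j, w)" by (cases jw)
    have "j \<in> edges \<Gamma>"
      using y unfolding vertices_H Inr jw by (auto simp: glue_def split: if_splits)
    then show ?thesis using green_kernelD(2)[OF g] by (simp add: gH_def ext_def loc_def Inr jw)
  qed
  fix f :: "'a + 'b \<times> 'c \<Rightarrow> real"
  let ?f = "\<lambda>v. f (Inl v)" and ?g = "\<lambda>a. ext (g a) y"
  let ?X = "\<lambda>i. case y of Inl _ \<Rightarrow> 0 | Inr (j, w) \<Rightarrow> if j = i then f y - ext ?f y else 0"
  have "energy (B i) (\<lambda>w. gH (gl i w) y) (\<lambda>w. f (gl i w)) =
      (?g (tgt \<Gamma> i) - ?g (src \<Gamma> i)) * (?f (tgt \<Gamma> i) - ?f (src \<Gamma> i)) / len \<Gamma> i + ?X i"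
    if i: "i \<in> edges \<Gamma>" for i
    unfolding gH_def ext_glue[OF i] energy_add_left energy_scale_left energy_const_left
      energy_\<phi>[OF i] energy_loc[OF i y] glue_p glue_q[OF i] by simp
  then have "energy H (\<lambda>x. gH x y) f = energy \<Gamma> ?g ?f + sum ?X (edges \<Gamma>)"
    unfolding energy_H by (simp add: sum.distrib energy_def)
  also have "sum ?X (edges \<Gamma>) = f y - ext ?f y"
  proof (cases y)
    case (Inl v)
    then show ?thesis by (simp add: ext_def)
  next
    case (Inr jw)
    obtain j w where jw: "jw = (j, w)" by (cases jw)
    have "j \<in> edges \<Gamma>"
      using y unfolding vertices_H Inr jw by (auto simp: glue_def split: if_splits)
    then show ?thesis by (simp add: Inr jw)
  qed
  finally show "energy H (\<lambda>x. gH x y) f = f y - f (Inl z0)"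
    unfolding energy_ext[OF y] by simp
qed

lemma gH_glue:
  assumes i: "i \<in> edges \<Gamma>" and w: "w \<in> vertices (\<beta> i)" and w': "w' \<in> vertices (\<beta> i)"
  defines "u \<equiv> src \<Gamma> i" and "v \<equiv> tgt \<Gamma> i" and "L \<equiv> len \<Gamma> i"
  shows "gH (gl i w) (gl i w') = g u u + (g u v - g u u) * (\<phi> i w + \<phi> i w') / L +
    (g u u + g v v - 2 * g u v) * \<phi> i w * \<phi> i w' / L\<^sup>2 + (k i w w' - \<phi> i w * \<phi> i w' / L)"
proof -
  have "g v u = g u v" unfolding u_def v_def by (rule green_kernel_sym[OF g]) (use i in auto)
  then show ?thesis
    unfolding gH_def ext_glue[OF i] loc_glue[OF assms(1-3)] K_def
      u_def[symmetric] v_def[symmetric] L_def[symmetric]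
    using i by (simp add: L_def field_simps power2_eq_square)
qed

text \<open>The computation of \<open>point_kernel_diag\<close> with \<open>\<phi> i w\<close> in
  place of \<open>t\<close>; the local kernel adds the last summand. This is the form of
  \<open>d\<close> required by \<open>inserted_graph_contribution\<close>.\<close>

lemma gH_diag:
  assumes i: "i \<in> edges \<Gamma>" and w: "w \<in> vertices (\<beta> i)"
  defines "u \<equiv> src \<Gamma> i" and "v \<equiv> tgt \<Gamma> i" and "L \<equiv> len \<Gamma> i"
  shows "gH (gl i w) (gl i w) = g u u + (g v v - g u u) / L * \<phi> i w +
    edge_slack \<Gamma> i * (\<phi> i w * (L - \<phi> i w) / L) + (k i w w - \<phi> i w)"
proof -
  have "L \<noteq> 0" using i by (simp add: L_def)
  define r where "r = g u u + g v v - 2 * g u v"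
  have slack: "edge_slack \<Gamma> i = 1 - r / L"
    unfolding edge_slack_def r_def u_def v_def L_def using \<Gamma>.eff_res_vertices[OF g] i by simp
  have gv: "g v v = r - g u u + 2 * g u v" by (simp add: r_def)
  show ?thesis
    unfolding gH_glue[OF i w w] u_def[symmetric] v_def[symmetric] L_def[symmetric] r_def[symmetric] slack
    unfolding gv using \<open>L \<noteq> 0\<close> by (simp add: field_simps power2_eq_square)
qed

text \<open>The rest of the network is connected to \<open>B i\<close> at its terminals and changes
  the resistance across \<open>e\<close> by minus the slack of \<open>i\<close> times the squared
  drop of \<open>\<phi> i\<close> over \<open>len \<Gamma> i\<close>.\<close>

lemma edge_slack_H:
  assumes i: "i \<in> edges \<Gamma>" and e: "e \<in> edges (B i)"
  shows "edge_slack H (i, e) = edge_slack (B i) e +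
    edge_slack \<Gamma> i * (\<phi> i (tgt (B i) e) - \<phi> i (src (B i) e))\<^sup>2 / (len \<Gamma> i * len (B i) e)"
proof -
  interpret Bi: metrized "B i" by (rule metrized_B[OF i])
  let ?u = "src \<Gamma> i" and ?v = "tgt \<Gamma> i" and ?x = "src (B i) e" and ?y = "tgt (B i) e"
  define L where "L = len \<Gamma> i"
  define r where "r = g ?u ?u + g ?v ?v - 2 * g ?u ?v"
  have "L \<noteq> 0" using i by (simp add: L_def)
  have x: "?x \<in> vertices (\<beta> i)" "?y \<in> vertices (\<beta> i)"
    using Bi.src_in[OF e] Bi.tgt_in[OF e] by simp_all
  have xH: "gl i ?x \<in> vertices H" "gl i ?y \<in> vertices H"
    unfolding vertices_H using i x by auto
  have "eff_res H (Vertex (gl i ?x)) (Vertex (gl i ?y)) =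
      gH (gl i ?x) (gl i ?x) + gH (gl i ?y) (gl i ?y) - 2 * gH (gl i ?x) (gl i ?y)"
    by (rule H.eff_res_vertices[OF green_kernel_H xH])
  also have "\<dots> = eff_res (B i) (Vertex ?x) (Vertex ?y) + (r / L\<^sup>2 - 1 / L) * (\<phi> i ?y - \<phi> i ?x)\<^sup>2"
    unfolding gH_glue[OF i x(1) x(1)] gH_glue[OF i x(2) x(2)] gH_glue[OF i x]
      Bi.eff_res_vertices[OF k[OF i] Bi.src_in[OF e] Bi.tgt_in[OF e]] L_def[symmetric] r_def[symmetric]
    by (simp add: power2_eq_square algebra_simps add_divide_distrib diff_divide_distrib)
  also have "r / L\<^sup>2 - 1 / L = - edge_slack \<Gamma> i / L"
  proof -
    have "eff_res \<Gamma> (Vertex ?u) (Vertex ?v) = r"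
      using \<Gamma>.eff_res_vertices[OF g, of ?u ?v] i by (simp add: r_def)
    then show ?thesis
      unfolding edge_slack_def L_def[symmetric]
      using \<open>L \<noteq> 0\<close> by (simp add: field_simps power2_eq_square)
  qed
  finally have "eff_res H (Vertex (gl i ?x)) (Vertex (gl i ?y)) = eff_res (B i) (Vertex ?x) (Vertex ?y) -
      edge_slack \<Gamma> i * (\<phi> i ?y - \<phi> i ?x)\<^sup>2 / L" by simp
  then show ?thesis
    unfolding edge_slack_def[of H] edge_slack_def[of "B i"] src_H tgt_H len_H L_def
    by (simp add: diff_divide_distrib)
qed

text \<open>In the contributions of the inserted graphs, the terms with \<open>?a\<close> add up to
  the energy of the diagonal of \<open>g\<close> and the terms with the squared slack of
  \<open>i\<close> to the slack sum of \<Gamma>, which together are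
  \<open>4 * tau \<Gamma>\<close>.\<close>

lemma tau_H_kernels:
  "4 * tau H = 4 * tau \<Gamma> + (\<Sum>i\<in>edges \<Gamma>. - len \<Gamma> i + 4 * tau (B i) +
     4 * edge_slack \<Gamma> i * A_const (B i) (Vertex (p i)) (Vertex (q i)) / len \<Gamma> i)"
proof -
  let ?d = "\<lambda>x. gH x x"
  let ?a = "\<lambda>i. (g (tgt \<Gamma> i) (tgt \<Gamma> i) - g (src \<Gamma> i) (src \<Gamma> i)) / len \<Gamma> i"
  have "4 * tau H = (\<Sum>i\<in>edges \<Gamma>. energy (B i) (\<lambda>w. ?d (gl i w)) (\<lambda>w. ?d (gl i w)) +
      (\<Sum>e\<in>edges (B i). (edge_slack H (i, e))\<^sup>2 * len (B i) e) / 3)"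
    unfolding H.tau_green[OF green_kernel_H] energy_H sum_edges_H len_H
    by (simp add: sum.distrib sum_divide_distrib)
  also have "\<dots> = (\<Sum>i\<in>edges \<Gamma>. (?a i)\<^sup>2 * len \<Gamma> i + (edge_slack \<Gamma> i)\<^sup>2 * len \<Gamma> i / 3 +
      (- len \<Gamma> i + 4 * tau (B i) +
       4 * edge_slack \<Gamma> i * A_const (B i) (Vertex (p i)) (Vertex (q i)) / len \<Gamma> i))"
  proof (rule sum.cong)
    fix i assume i: "i \<in> edges \<Gamma>"
    interpret Bi: metrized "B i" by (rule metrized_B[OF i])
    have "energy (B i) (\<lambda>w. ?d (gl i w)) (\<lambda>w. ?d (gl i w)) + (\<Sum>e\<in>edges (B i). (edge_slack (B i) e +
        edge_slack \<Gamma> i * (k i (tgt (B i) e) (q i) - k i (src (B i) e) (q i))\<^sup>2 / (len \<Gamma> i * len (B i) e))\<^sup>2 * len (B i) e) / 3 =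
      (?a i)\<^sup>2 * len \<Gamma> i + (edge_slack \<Gamma> i)\<^sup>2 * len \<Gamma> i / 3 - len \<Gamma> i + 4 * tau (B i) +
      4 * edge_slack \<Gamma> i * A_const (B i) (Vertex (p i)) (Vertex (q i)) / len \<Gamma> i"
    proof (rule Bi.inserted_graph_contribution[OF k[OF i]])
      show "len \<Gamma> i = k i (q i) (q i)" using \<phi>_ends[OF i] by (simp add: \<phi>_def)
      show "q i \<in> vertices (B i)" "q i \<noteq> p i" using i p_neq_q[OF i] by auto
      fix w assume "w \<in> vertices (B i)"
      then show "gH (gl i w) (gl i w) = g (src \<Gamma> i) (src \<Gamma> i) + ?a i * k i w (q i) +
          edge_slack \<Gamma> i * (k i w (q i) * (len \<Gamma> i - k i w (q i)) / len \<Gamma> i) + (k i w w - k i w (q i))"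
        using gH_diag[OF i] by (simp add: \<phi>_def)
    qed
    moreover have "(\<Sum>e\<in>edges (B i). (edge_slack H (i, e))\<^sup>2 * len (B i) e) =
      (\<Sum>e\<in>edges (B i). (edge_slack (B i) e +
        edge_slack \<Gamma> i * (k i (tgt (B i) e) (q i) - k i (src (B i) e) (q i))\<^sup>2 / (len \<Gamma> i * len (B i) e))\<^sup>2 * len (B i) e)"
      by (rule sum.cong) (simp_all only: edge_slack_H[OF i] \<phi>_def)
    ultimately show "energy (B i) (\<lambda>w. ?d (gl i w)) (\<lambda>w. ?d (gl i w)) +
        (\<Sum>e\<in>edges (B i). (edge_slack H (i, e))\<^sup>2 * len (B i) e) / 3 =
      (?a i)\<^sup>2 * len \<Gamma> i + (edge_slack \<Gamma> i)\<^sup>2 * len \<Gamma> i / 3 +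
      (- len \<Gamma> i + 4 * tau (B i) +
       4 * edge_slack \<Gamma> i * A_const (B i) (Vertex (p i)) (Vertex (q i)) / len \<Gamma> i)"
      by linarith
  qed simp
  also have "\<dots> = (\<Sum>i\<in>edges \<Gamma>. (?a i)\<^sup>2 * len \<Gamma> i) + (\<Sum>i\<in>edges \<Gamma>. (edge_slack \<Gamma> i)\<^sup>2 * len \<Gamma> i) / 3 +
      (\<Sum>i\<in>edges \<Gamma>. - len \<Gamma> i + 4 * tau (B i) +
       4 * edge_slack \<Gamma> i * A_const (B i) (Vertex (p i)) (Vertex (q i)) / len \<Gamma> i)"
    unfolding sum.distrib sum_divide_distrib ..
  also have "(\<Sum>i\<in>edges \<Gamma>. (?a i)\<^sup>2 * len \<Gamma> i) = energy \<Gamma> (\<lambda>v. g v v) (\<lambda>v. g v v)"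
    unfolding energy_def by (rule sum.cong) (auto simp: power2_eq_square)
  finally show ?thesis using \<Gamma>.tau_green[OF g] by simp
qed

end

context replacement
begin

lemma tau_H: "tau H = tau \<Gamma> - total_length \<Gamma> / 4 + (\<Sum>i\<in>edges \<Gamma>. tau (B i) +
     edge_slack \<Gamma> i / len \<Gamma> i * A_const (B i) (Vertex (p i)) (Vertex (q i)))"
proof -
  obtain z0 g where g: "green_kernel \<Gamma> z0 g"
    using \<Gamma>.vertices_nonempty \<Gamma>.green_kernel_exists by blast
  have "\<exists>k. green_kernel (B i) (p i) k" if i: "i \<in> edges \<Gamma>" for i
    using metrized.green_kernel_exists[OF metrized_B[OF i], of "p i"] p_in[OF i] by auto
  then obtain k where k: "\<And>i. i \<in> edges \<Gamma> \<Longrightarrow> green_kernel (B i) (p i) (k i)" by metis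
  interpret replacement_kernels \<Gamma> \<beta> p q z0 g k
    by unfold_locales (fact g, fact k)
  have "4 * tau H = 4 * tau \<Gamma> - total_length \<Gamma> + 4 * (\<Sum>i\<in>edges \<Gamma>. tau (B i) +
     edge_slack \<Gamma> i / len \<Gamma> i * A_const (B i) (Vertex (p i)) (Vertex (q i)))"
    unfolding tau_H_kernels total_length_def
    by (simp add: sum.distrib sum_subtractf sum_distrib_left mult.assoc)
  then show ?thesis by simp
qed

end

section \<open>Normalization and return to the original inserted graphs\<close>

theorem theorem4p10:
  fixes \<Gamma> :: "('v, 'e) mgraph"
    and \<beta> :: "'e \<Rightarrow> ('w, 'f) mgraph"
    and p q :: "'e \<Rightarrow> 'w"
  assumes "metrized_graph \<Gamma>"
    and "total_length \<Gamma> = 1"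
    and "\<And>i. i \<in> edges \<Gamma> \<Longrightarrow> metrized_graph (\<beta> i)"
    and "\<And>i. i \<in> edges \<Gamma> \<Longrightarrow> total_length (\<beta> i) = 1"
    and "\<And>i. i \<in> edges \<Gamma> \<Longrightarrow> p i \<in> vertices (\<beta> i)"
    and "\<And>i. i \<in> edges \<Gamma> \<Longrightarrow> q i \<in> vertices (\<beta> i)"
    and "\<And>i. i \<in> edges \<Gamma> \<Longrightarrow> p i \<noteq> q i"
  shows "tau (normalization (edge_replacement \<Gamma> \<beta> p q)) *
           (\<Sum>i\<in>edges \<Gamma>. len \<Gamma> i / eff_res (\<beta> i) (Vertex (p i)) (Vertex (q i))) =
         tau \<Gamma> - 1/4 +
           (\<Sum>i\<in>edges \<Gamma>.
              len \<Gamma> i * tau (\<beta> i) / eff_res (\<beta> i) (Vertex (p i)) (Vertex (q i)) +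
              (len \<Gamma> i)\<^sup>2 * A_const (\<beta> i) (Vertex (p i)) (Vertex (q i)) *
                real_of_ereal (1 / (ereal (len \<Gamma> i) + edge_res \<Gamma> i)) /
                (eff_res (\<beta> i) (Vertex (p i)) (Vertex (q i)))\<^sup>2)"
proof -
  interpret replacement \<Gamma> \<beta> p q
    by unfold_locales (use assms in auto)
  \<comment> \<open>Since the inserted graphs have unit length, the length of the new graph is the
    sum that multiplies \<open>tau\<close> in the claim.\<close>
  have "total_length H = (\<Sum>i\<in>edges \<Gamma>. ratio i * total_length (\<beta> i))"
    unfolding total_length_def sum_edges_H len_H
    by (simp add: B_def sum_distrib_left mult.commute)
  then have len: "total_length H = (\<Sum>i\<in>edges \<Gamma>. ratio i)"
    using assms(4) by simp
  \<comment> \<open>Unit total length excludes a single vertex without edges, so the normalizing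
    factor is positive.\<close>
  have "edges \<Gamma> \<noteq> {}" using assms(2) by (auto simp: total_length_def)
  then have pos: "0 < total_length H"
    unfolding len using ratio_pos by (intro sum_pos) auto
  have "tau (normalization H) * total_length H = tau H"
    using H.tau_rescale[of "1 / total_length H"] pos by (simp add: normalization_eq_rescale)
  also have "tau H = tau \<Gamma> - 1/4 + (\<Sum>i\<in>edges \<Gamma>. tau (B i) +
     edge_slack \<Gamma> i / len \<Gamma> i * A_const (B i) (Vertex (p i)) (Vertex (q i)))"
    unfolding tau_H assms(2) ..
  also have "(\<Sum>i\<in>edges \<Gamma>. tau (B i) +
       edge_slack \<Gamma> i / len \<Gamma> i * A_const (B i) (Vertex (p i)) (Vertex (q i))) =
    (\<Sum>i\<in>edges \<Gamma>.
      len \<Gamma> i * tau (\<beta> i) / eff_res (\<beta> i) (Vertex (p i)) (Vertex (q i)) +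
      (len \<Gamma> i)\<^sup>2 * A_const (\<beta> i) (Vertex (p i)) (Vertex (q i)) *
        real_of_ereal (1 / (ereal (len \<Gamma> i) + edge_res \<Gamma> i)) /
        (eff_res (\<beta> i) (Vertex (p i)) (Vertex (q i)))\<^sup>2)"
  proof (rule sum.cong)
    fix i assume i: "i \<in> edges \<Gamma>"
    interpret b: metrized "\<beta> i" by unfold_locales (rule assms(3)[OF i])
    show "tau (B i) + edge_slack \<Gamma> i / len \<Gamma> i * A_const (B i) (Vertex (p i)) (Vertex (q i)) =
      len \<Gamma> i * tau (\<beta> i) / eff_res (\<beta> i) (Vertex (p i)) (Vertex (q i)) +
      (len \<Gamma> i)\<^sup>2 * A_const (\<beta> i) (Vertex (p i)) (Vertex (q i)) *
        real_of_ereal (1 / (ereal (len \<Gamma> i) + edge_res \<Gamma> i)) /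
        (eff_res (\<beta> i) (Vertex (p i)) (Vertex (q i)))\<^sup>2"
      \<comment> \<open>\<open>A_const\<close> scales by the square of \<open>ratio i\<close>, which
        produces both squares in the claim; the slack over the length is the factor with the
        resistance of the deleted graph.\<close>
      unfolding B_def b.tau_rescale[OF ratio_pos[OF i]] \<Gamma>.inverse_len_plus_edge_res[OF i]
        b.A_const_rescale[OF ratio_pos[OF i] p_in[OF i] q_in[OF i]]
      by (simp add: ratio_def power_divide)
  qed simp
  finally show ?thesis unfolding len ratio_def .
qed

end
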